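(* Let $\mathcal{G}=(A,(\preceq_i)_{i\in\mathcal{P}})$ be a game in which each preference relation $\preceq_i$ is an $\omega$-recognizable preorder that is total and prefix-independent. Then a play $\rho=\rho_0\rho_1\dots$ is the outcome of a Nash equilibrium from $\rho_0$ if and only if for every $n$ and every player $i$ with $\rho_n\in V_i$, we have $val_i(\rho_n)\preceq_i[\rho]_i$.
   Context: An arena is $A=(V,E,\mathcal{P},(V_i)_i)$ with finite vertex set $V$, edges $E$ (every vertex has a successor), finite player set $\mathcal{P}$ and partition $(V_i)_i$. A relation on $V^\omega$ is $\omega$-recognizable if it equals $\bigcup_{k}X_k\times Y_k$ with $X_k,Y_k$ $\omega$-regular; a preorder is reflexive and transitive; total if any two words are comparable. A relation $R$ is prefix-independent if for all $x,y\in V^\omega$: $(x,y)\in R\Leftrightarrow\forall u,v\in V^*,(ux,vy)\in R$. Let $x\prec_i y$ iff $x\preceq_i y$ and $y\not\preceq_i x$, and $x\sim_i y$ iff $x\preceq_i y$ and $y\preceq_i x$; $[x]_i$ is the $\sim_i$-class of $x$ (finitely many classes since $\preceq_i$ is $\omega$-recognizable), and classes are ordered by $[x]_i\preceq_i[y]_i$ iff $x\preceq_i y$. Let $\Sigma_i$ be the set of strategies of player $i$ (maps from histories ending in $V_i$ to successors). The value is $val_i(v)=\max_{\sigma_i\in\Sigma_i}\min\{[\pi]_i\mid\pi \text{ a play consistent with }\sigma_i,\ \pi_0=v\}$. A Nash equilibrium from $v_0$ is a profile $\sigma$ with $\langle\sigma\rangle_{v_0}\not\prec_i\langle\tau_i,\sigma_{-i}\rangle_{v_0}$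 for every $i$ and every strategy $\tau_i$ ($\langle\cdot\rangle_{v_0}$ is the outcome). *)

theory Defs
  imports Main "HOL-Library.Omega_Words_Fun"
begin

definition buchi_accepts ::
  "nat set \<Rightarrow> nat set \<Rightarrow> (nat \<times> 'a \<times> nat) set \<Rightarrow> nat set \<Rightarrow> 'a word \<Rightarrow> bool" where
  "buchi_accepts Q I \<delta> F w \<longleftrightarrow>
     (\<exists>r :: nat word. r 0 \<in> I \<and> (\<forall>n. (r n, w n, r (Suc n)) \<in> \<delta>) \<and> (\<exists>\<^sub>\<infinity> n. r n \<in> F))"

definition omega_regular :: "'a word set \<Rightarrow> bool" where
  "omega_regular L \<longleftrightarrow>
     (\<exists>Q I \<delta> F. finite Q \<and> I \<subseteq> Q \<and> F \<subseteq> Q \<and> \<delta> \<subseteq> Q \<times> UNIV \<times> Q \<and>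
        L = {w. buchi_accepts Q I \<delta> F w})"

definition omega_recognizable :: "('a word \<times> 'a word) set \<Rightarrow> bool" where
  "omega_recognizable R \<longleftrightarrow>
     (\<exists>(n::nat) X Y. (\<forall>k<n. omega_regular (X k) \<and> omega_regular (Y k)) \<and>
        R = (\<Union>k<n. X k \<times> Y k))"

definition prefix_independent :: "('a word \<times> 'a word) set \<Rightarrow> bool" where
  "prefix_independent R \<longleftrightarrow>
     (\<forall>x y. (x, y) \<in> R \<longleftrightarrow> (\<forall>u v. (u \<frown> x, v \<frown> y) \<in> R))"

definition strict_pref :: "('a \<times> 'a) set \<Rightarrow> 'a \<Rightarrow> 'a \<Rightarrow> bool" where
  "strict_pref R x y \<longleftrightarrow> (x, y) \<in> R \<and> (y, x) \<notin> R"

definition cls :: "('a \<times> 'a) set \<Rightarrow> 'a \<Rightarrow> 'a set" where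
  "cls R x = {y. (x, y) \<in> R \<and> (y, x) \<in> R}"

text \<open>Order on classes: [x] below [y] iff x below y (well defined for preorders).\<close>
definition cls_le :: "('a \<times> 'a) set \<Rightarrow> 'a set \<Rightarrow> 'a set \<Rightarrow> bool" where
  "cls_le R C D \<longleftrightarrow> (\<exists>x y. C = cls R x \<and> D = cls R y \<and> (x, y) \<in> R)"

text \<open>Arena: vertex type 'v (finite), edge relation E, owner function own : V -> players.
  V_i = {v. own v = i}.\<close>

definition is_play :: "('v \<times> 'v) set \<Rightarrow> 'v word \<Rightarrow> bool" where
  "is_play E \<pi> \<longleftrightarrow> (\<forall>n. (\<pi> n, \<pi> (Suc n)) \<in> E)"

definition is_history :: "('v \<times> 'v) set \<Rightarrow> 'v list \<Rightarrow> bool" where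
  "is_history E h \<longleftrightarrow> h \<noteq> [] \<and> (\<forall>k. Suc k < length h \<longrightarrow> (h ! k, h ! Suc k) \<in> E)"

definition strategies :: "('v \<times> 'v) set \<Rightarrow> ('v \<Rightarrow> 'p) \<Rightarrow> 'p \<Rightarrow> ('v list \<Rightarrow> 'v) set" where
  "strategies E own i =
     {\<sigma>. \<forall>h. is_history E h \<and> own (last h) = i \<longrightarrow> (last h, \<sigma> h) \<in> E}"

definition consistent ::
  "('v \<times> 'v) set \<Rightarrow> ('v \<Rightarrow> 'p) \<Rightarrow> 'p \<Rightarrow> ('v list \<Rightarrow> 'v) \<Rightarrow> 'v word \<Rightarrow> bool" where
  "consistent E own i \<sigma> \<pi> \<longleftrightarrow>
     is_play E \<pi> \<and> (\<forall>n. own (\<pi> n) = i \<longrightarrow> \<pi> (Suc n) = \<sigma> (prefix (Suc n) \<pi>))"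

fun out_hist :: "('v \<Rightarrow> 'p) \<Rightarrow> ('p \<Rightarrow> 'v list \<Rightarrow> 'v) \<Rightarrow> 'v \<Rightarrow> nat \<Rightarrow> 'v list" where
  "out_hist own \<sigma> v0 0 = [v0]"
| "out_hist own \<sigma> v0 (Suc n) =
     (let h = out_hist own \<sigma> v0 n in h @ [\<sigma> (own (last h)) h])"

definition outcome :: "('v \<Rightarrow> 'p) \<Rightarrow> ('p \<Rightarrow> 'v list \<Rightarrow> 'v) \<Rightarrow> 'v \<Rightarrow> 'v word" where
  "outcome own \<sigma> v0 = (\<lambda>n. last (out_hist own \<sigma> v0 n))"

definition min_cls ::
  "('v \<times> 'v) set \<Rightarrow> ('v \<Rightarrow> 'p) \<Rightarrow> ('v word \<times> 'v word) set \<Rightarrow> 'p \<Rightarrow> ('v list \<Rightarrow> 'v) \<Rightarrow> 'v \<Rightarrow> 'v word set" where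
  "min_cls E own R i \<sigma> v =
     (THE C. C \<in> {cls R \<pi> | \<pi>. consistent E own i \<sigma> \<pi> \<and> \<pi> 0 = v} \<and>
        (\<forall>D \<in> {cls R \<pi> | \<pi>. consistent E own i \<sigma> \<pi> \<and> \<pi> 0 = v}. cls_le R C D))"

definition val ::
  "('v \<times> 'v) set \<Rightarrow> ('v \<Rightarrow> 'p) \<Rightarrow> ('v word \<times> 'v word) set \<Rightarrow> 'p \<Rightarrow> 'v \<Rightarrow> 'v word set" where
  "val E own R i v =
     (THE C. C \<in> {min_cls E own R i \<sigma> v | \<sigma>. \<sigma> \<in> strategies E own i} \<and>
        (\<forall>D \<in> {min_cls E own R i \<sigma> v | \<sigma>. \<sigma> \<in> strategies E own i}. cls_le R D C))"

definition nash_eq ::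
  "('v \<times> 'v) set \<Rightarrow> 'p set \<Rightarrow> ('v \<Rightarrow> 'p) \<Rightarrow> ('p \<Rightarrow> ('v word \<times> 'v word) set)
    \<Rightarrow> ('p \<Rightarrow> 'v list \<Rightarrow> 'v) \<Rightarrow> 'v \<Rightarrow> bool" where
  "nash_eq E P own pref \<sigma> v0 \<longleftrightarrow>
     (\<forall>i\<in>P. \<sigma> i \<in> strategies E own i) \<and>
     (\<forall>i\<in>P. \<forall>\<tau>\<in>strategies E own i.
        \<not> strict_pref (pref i) (outcome own \<sigma> v0) (outcome own (\<sigma>(i := \<tau>)) v0))"

end

theory Submission
  imports Defs "HOL-Library.Ramsey"
begin

unbundle no funcset_syntax

text \<open>Every set \<open>{\<pi>. \<pi> \<preceq>\<^sub>i \<rho>}\<close> is a tail-invariant \<open>\<omega>\<close>-regular objective. For such an objective, if player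
  \<open>i\<close> cannot guarantee an outcome strictly above \<open>\<rho>\<close> from \<open>\<rho> n\<close>, then by determinacy the other players can
  punish \<open>i\<close> for leaving \<open>\<rho>\<close> there; these punishments make \<open>\<rho>\<close> an equilibrium outcome. Conversely, a strategy
  guaranteeing more than \<open>\<rho>\<close> from some \<open>\<rho> n\<close> is a profitable deviation.

  Determinacy is obtained without determinizing automata. In a finite semigroup recognizing a tail-invariant
  language, an infinite word has an idempotent Ramsey value, and membership depends only on the two-sided ideal
  it generates. So membership is decided by the first, in a list ordered by size, of the ideals entered
  infinitely often. Such a parity-like objective is determined on the tree of histories, by induction on the list.\<close>

subsection \<open>Determinacy on trees of histories\<close>

text \<open>The sets in the list consist of histories, not of vertices, so the determinacy proof
  cannot rest on positions that recur. It needs a statement stable under induction: games in which a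
  partial map \<open>st\<close> may already have named the winner at some histories. Removing the
  leading set \<open>H\<close> turns its visits, together with the opponent's winning histories,
  into such stops. Since that winning region is taken whole, no transfinite approximation occurs;
  the price is that strategies may be restarted infinitely often, which the anchors organise.

  Prefix-independence acts twice: it makes the objective tail-invariant, and it lets a play that
  branches off at \<open>\<rho> n\<close> be compared with \<open>\<rho>\<close> through its suffix,
  so that a value attached to a vertex speaks about deviations after a long history. Recognizability
  also leaves only finitely many classes, hence the extrema in the value exist; totality turns "not
  strictly better" into "at most as good".\<close>

lemma prefix_eq_le:
  assumes "prefix m x = prefix m y" "k \<le> m"
  shows "prefix k x = prefix k y"
  using assms by (metis add_0 min.absorb2 min.commute subsequence_take)

lemma prefix_eqD: "prefix m x = prefix m y \<Longrightarrow> k < m \<Longrightarrow> x k = y k"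
  by (metis add_0 diff_zero subsequence_nth)

text \<open>Positions are the histories themselves, so that no strategy has to be positional.\<close>

locale tree_game =
  fixes M :: "'a list \<Rightarrow> 'a set" and turn :: "'a list \<Rightarrow> bool"
  assumes moves_nonempty: "M h \<noteq> {}"
begin

text \<open>Legality is asked at every history, the opponent's included: the same \<open>s\<close>
  can then move for both sides when a finite piece of play is completed to an infinite one.\<close>

definition legal :: "('a list \<Rightarrow> 'a) \<Rightarrow> bool" where
  "legal s \<longleftrightarrow> (\<forall>h. s h \<in> M h)"

text \<open>The players are the truth values, \<open>b\<close> moving where \<open>turn\<close>
  equals \<open>b\<close>. Moves inside \<open>h\<close> are not checked, so every history may serve
  as a root.\<close>

definition follows :: "bool \<Rightarrow> ('a list \<Rightarrow> 'a) \<Rightarrow> 'a list \<Rightarrow> 'a word \<Rightarrow> bool" where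
  "follows b s h \<pi> \<longleftrightarrow> prefix (length h) \<pi> = h \<and>
     (\<forall>m\<ge>length h. \<pi> m \<in> M (prefix m \<pi>) \<and> (turn (prefix m \<pi>) = b \<longrightarrow> \<pi> m = s (prefix m \<pi>)))"

definition wins :: "bool \<Rightarrow> ('a word \<Rightarrow> bool) \<Rightarrow> 'a list \<Rightarrow> bool" where
  "wins b \<Phi> h \<longleftrightarrow> (\<exists>s. legal s \<and> (\<forall>\<pi>. follows b s h \<pi> \<longrightarrow> \<Phi> \<pi>))"

lemma ex_legal: "\<exists>s. legal s"
  unfolding legal_def using moves_nonempty by (meson ex_in_conv)

end

lemma ex_generated_word: "\<exists>\<pi>. prefix (length g) \<pi> = g \<and> (\<forall>m\<ge>length g. \<pi> m = s (prefix m \<pi>))"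
proof -
  define G where "G = rec_nat g (\<lambda>_ h. h @ [s h])"
  have G0: "G 0 = g" and GS: "G (Suc n) = G n @ [s (G n)]" for n
    by (simp_all add: G_def)
  have len: "length (G n) = length g + n" for n
    by (induction n) (simp_all add: G0 GS)
  have ext: "G b ! j = G a ! j" if "a \<le> b" "j < length (G a)" for a b j
    using that by (induction b rule: dec_induct) (auto simp: GS len nth_append)
  \<comment> \<open>\<open>G (Suc m)\<close> has more than \<open>m\<close> entries even if
    \<open>g\<close> is empty, and by \<open>ext\<close> all longer stages agree there.\<close>
  define \<pi> where "\<pi> m = G (Suc m) ! m" for m
  have pre: "prefix (length g + n) \<pi> = G n" for n
  proof (rule nth_equalityI)
    fix j assume "j < length (prefix (length g + n) \<pi>)"
    then have j: "j < length g + n" by simp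
    have "G (Suc j) ! j = G n ! j"
      using j ext[of n "Suc j" j] ext[of "Suc j" n j] by (cases "n \<le> Suc j") (simp_all add: len)
    then show "prefix (length g + n) \<pi> ! j = G n ! j"
      using j by (simp add: \<pi>_def)
  qed (simp add: len)
  have "\<pi> m = s (prefix m \<pi>)" if "m \<ge> length g" for m
  proof -
    obtain n where m: "m = length g + n" using \<open>m \<ge> length g\<close> le_Suc_ex by blast
    have "\<pi> m = G (Suc n) ! m"
      unfolding \<pi>_def using ext[of "Suc n" "Suc m" m] by (simp add: m len)
    also have "\<dots> = s (G n)"
      by (simp add: GS nth_append len m)
    finally show ?thesis by (simp add: m pre)
  qed
  moreover have "prefix (length g) \<pi> = g" using pre[of 0] by (simp add: G0)
  ultimately show ?thesis by blast
qed

text \<open>A history \<open>g\<close> with \<open>st g = Some b\<close> is decided for player \<open>b\<close>.\<close>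

definition stopped_obj ::
  "('a list \<Rightarrow> bool option) \<Rightarrow> ('a word \<Rightarrow> bool) \<Rightarrow> nat \<Rightarrow> 'a word \<Rightarrow> bool" where
  "stopped_obj st \<Phi> n \<pi> \<longleftrightarrow>
     (if \<exists>m\<ge>n. st (prefix m \<pi>) \<noteq> None
      then the (st (prefix (LEAST m. n \<le> m \<and> st (prefix m \<pi>) \<noteq> None) \<pi>)) else \<Phi> \<pi>)"

lemma stopped_obj_stop:
  assumes "n \<le> m" "st (prefix m \<pi>) = Some c" "\<forall>k. n \<le> k \<and> k < m \<longrightarrow> st (prefix k \<pi>) = None"
  shows "stopped_obj st \<Phi> n \<pi> = c"
proof -
  have "(LEAST m. n \<le> m \<and> st (prefix m \<pi>) \<noteq> None) = m"
    by (rule Least_equality) (use assms in \<open>force simp: not_less[symmetric]\<close>)+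
  then show ?thesis using assms unfolding stopped_obj_def by auto
qed

lemma stopped_obj_none:
  "\<forall>m\<ge>n. st (prefix m \<pi>) = None \<Longrightarrow> stopped_obj st \<Phi> n \<pi> = \<Phi> \<pi>"
  unfolding stopped_obj_def by (subst if_not_P) auto

lemma first_stop:
  assumes "\<exists>m\<ge>n. P m"
  obtains m where "n \<le> (m::nat)" "P m" "\<forall>k. n \<le> k \<and> k < m \<longrightarrow> \<not> P k"
  using exists_least_iff[of "\<lambda>m. n \<le> m \<and> P m"] assms by blast

lemma stopped_obj_cases:
  assumes "\<And>m c. n \<le> m \<Longrightarrow> st (prefix m \<pi>) = Some c \<Longrightarrow>
              \<forall>k. n \<le> k \<and> k < m \<longrightarrow> st (prefix k \<pi>) = None \<Longrightarrow> c = d"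
    and "\<forall>m\<ge>n. st (prefix m \<pi>) = None \<Longrightarrow> \<Phi> \<pi> = d"
  shows "stopped_obj st \<Phi> n \<pi> = d"
proof (cases "\<exists>m\<ge>n. st (prefix m \<pi>) \<noteq> None")
  case True
  then obtain m where m: "n \<le> m" "st (prefix m \<pi>) \<noteq> None"
      "\<forall>k. n \<le> k \<and> k < m \<longrightarrow> \<not> st (prefix k \<pi>) \<noteq> None"
    by (rule first_stop)
  then obtain c where "st (prefix m \<pi>) = Some c" by blast
  with m assms(1)[of m c] stopped_obj_stop[of n m st \<pi> c] show ?thesis by blast
next
  case False
  then show ?thesis using assms(2) stopped_obj_none by metis
qed

lemma stopped_obj_shift:
  assumes "n \<le> m" "\<forall>k. n \<le> k \<and> k < m \<longrightarrow> st (prefix k \<pi>) = None"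
  shows "stopped_obj st \<Phi> n \<pi> = stopped_obj st \<Phi> m \<pi>"
proof (rule stopped_obj_cases)
  fix j c assume j: "n \<le> j" "st (prefix j \<pi>) = Some c" "\<forall>k. n \<le> k \<and> k < j \<longrightarrow> st (prefix k \<pi>) = None"
  then have "m \<le> j" using assms by (metis leI option.distinct(1))
  then show "c = stopped_obj st \<Phi> m \<pi>"
    using stopped_obj_stop[of m j st \<pi> c] j assms by auto
next
  assume "\<forall>m\<ge>n. st (prefix m \<pi>) = None"
  then show "\<Phi> \<pi> = stopped_obj st \<Phi> m \<pi>"
    using stopped_obj_none[of m st \<pi>] assms(1) by (metis le_trans)
qed

context tree_game
begin

text \<open>Winning is a property of infinite plays. Completing a conforming finite piece by
  \<open>s\<close> itself transfers it to finite histories, for instance to exclude a wrong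
  stop.\<close>

lemma follows_extend:
  assumes "legal s" "a \<le> m"
    and "\<forall>k. a \<le> k \<and> k < m \<longrightarrow> \<pi> k \<in> M (prefix k \<pi>) \<and> (turn (prefix k \<pi>) = b \<longrightarrow> \<pi> k = s (prefix k \<pi>))"
  obtains \<pi>' where "follows b s (prefix a \<pi>) \<pi>'" "prefix m \<pi>' = prefix m \<pi>"
proof -
  obtain \<pi>' where p: "prefix m \<pi>' = prefix m \<pi>" "\<forall>k\<ge>m. \<pi>' k = s (prefix k \<pi>')"
    using ex_generated_word[of "prefix m \<pi>" s] by auto
  have "\<pi>' k \<in> M (prefix k \<pi>') \<and> (turn (prefix k \<pi>') = b \<longrightarrow> \<pi>' k = s (prefix k \<pi>'))" if "a \<le> k" for k
  proof (cases "k < m")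
    case True
    then show ?thesis
      using assms(3) that prefix_eq_le[OF p(1), of k] prefix_eqD[OF p(1), of k] by simp
  next
    case False
    then show ?thesis using p(2) assms(1) by (simp add: legal_def)
  qed
  then have "follows b s (prefix a \<pi>) \<pi>'"
    using prefix_eq_le[OF p(1) assms(2)] by (simp add: follows_def)
  then show thesis using p(1) that by blast
qed

text \<open>Combining strategies: \<open>s a\<close> is played as long as \<open>a\<close> is the anchor, and the current history
  becomes the new anchor whenever \<open>D\<close> holds.\<close>

definition anchored ::
  "('a list \<Rightarrow> 'a list \<Rightarrow> bool) \<Rightarrow> bool \<Rightarrow> ('a list \<Rightarrow> 'a list \<Rightarrow> 'a) \<Rightarrow> nat \<Rightarrow> 'a word \<Rightarrow> (nat \<Rightarrow> nat) \<Rightarrow> bool"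
where
  "anchored D b s n \<pi> anc \<longleftrightarrow> anc n = n \<and> (\<forall>m\<ge>n.
     anc (Suc m) = (if D (prefix (anc m) \<pi>) (prefix (Suc m) \<pi>) then Suc m else anc m) \<and>
     \<pi> m \<in> M (prefix m \<pi>) \<and> (turn (prefix m \<pi>) = b \<longrightarrow> \<pi> m = s (prefix (anc m) \<pi>) (prefix m \<pi>)))"

lemma anchor_glue:
  assumes "\<And>a. legal (s a)"
  obtains S where "legal S"
    and "\<And>\<pi>. follows b S h \<pi> \<Longrightarrow> \<exists>anc. anchored D b s (length h) \<pi> anc"
proof -
  define n where "n = length h"
  define A where
    "A \<pi> = rec_nat n (\<lambda>k r. if n \<le> k \<and> D (prefix r \<pi>) (prefix (Suc k) \<pi>) then Suc k else r)" for \<pi>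
  have A0: "A \<pi> 0 = n" for \<pi> by (simp add: A_def)
  have AS: "A \<pi> (Suc k) = (if n \<le> k \<and> D (prefix (A \<pi> k) \<pi>) (prefix (Suc k) \<pi>) then Suc k else A \<pi> k)"
    for \<pi> k by (simp add: A_def)
  have A_le: "A \<pi> k \<le> max n k" for \<pi> k
    by (induction k) (auto simp: A0 AS simp del: subseq_to_Suc)
  have A_start: "A \<pi> k = n" if "k \<le> n" for \<pi> k
    using that by (induction k) (auto simp: A0 AS simp del: subseq_to_Suc)
  have A_cong: "A \<pi> k = A \<pi>' k" if "prefix m \<pi> = prefix m \<pi>'" "n \<le> m" "k \<le> m" for \<pi> \<pi>' k m
    using that(3)
  proof (induction k)
    case (Suc k)
    then have IH: "A \<pi> k = A \<pi>' k" and le: "A \<pi> k \<le> m" using A_le[of \<pi> k] \<open>n \<le> m\<close> by auto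
    have "prefix (A \<pi> k) \<pi> = prefix (A \<pi>' k) \<pi>'" "prefix (Suc k) \<pi> = prefix (Suc k) \<pi>'"
      using prefix_eq_le[OF that(1)] le Suc.prems IH by metis+
    then show ?case unfolding AS using IH by simp
  qed (simp add: A0)
  \<comment> \<open>\<open>A\<close> reads infinite words, so the history is padded by
    \<open>undefined\<close>; by \<open>A_cong\<close> the anchor depends only on the part already
    played.\<close>
  define S where "S g = (let \<pi> = g \<frown> undefined in s (prefix (A \<pi> (length g)) \<pi>) g)" for g
  have "legal S" using assms by (simp add: legal_def S_def Let_def)
  moreover have "anchored D b s (length h) \<pi> (A \<pi>)" if fol: "follows b S h \<pi>" for \<pi>
  proof -
    have "S (prefix m \<pi>) = s (prefix (A \<pi> m) \<pi>) (prefix m \<pi>)" if "m \<ge> n" for m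
    proof -
      let ?\<pi> = "prefix m \<pi> \<frown> undefined"
      have eq: "prefix m ?\<pi> = prefix m \<pi>"
        using prefix_conc_length[of "prefix m \<pi>" undefined] by simp
      have "A ?\<pi> m = A \<pi> m" using A_cong[OF eq that] by simp
      moreover have "prefix (A \<pi> m) ?\<pi> = prefix (A \<pi> m) \<pi>"
        using prefix_eq_le[OF eq, of "A \<pi> m"] A_le[of \<pi> m] that by simp
      ultimately show ?thesis by (simp add: S_def Let_def)
    qed
    then show ?thesis
      using fol A_start[of n \<pi>] by (simp add: anchored_def follows_def n_def[symmetric] AS del: subseq_to_Suc)
  qed
  ultimately show thesis using that by blast
qed

lemma anchored_le: "anchored D b s n \<pi> anc \<Longrightarrow> n \<le> m \<Longrightarrow> n \<le> anc m \<and> anc m \<le> m"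
  unfolding anchored_def
  by (rotate_tac 1, induction m rule: dec_induct) (auto simp del: subseq_to_Suc)

text \<open>The anchor changes only by jumping to the current time, so the anchor in force at
  \<open>m\<close> was set at time \<open>anc m\<close> itself and has not moved since.\<close>

lemma anchored_const:
  "anchored D b s n \<pi> anc \<Longrightarrow> n \<le> m \<Longrightarrow> anc m \<le> k \<Longrightarrow> k \<le> m \<Longrightarrow> anc k = anc m"
proof (rotate_tac 1, induction m rule: dec_induct)
  case (step m)
  show ?case
  proof (cases "k = Suc m")
    case False
    then have "k \<le> m" using step by simp
    then show ?thesis using step by (auto simp: anchored_def simp del: subseq_to_Suc split: if_splits)
  qed simp
qed (simp add: anchored_def)

lemma anchored_follows:
  assumes "anchored D b s n \<pi> anc" "n \<le> a" "\<forall>m\<ge>a. anc m = a"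
  shows "follows b (s (prefix a \<pi>)) (prefix a \<pi>) \<pi>"
  using assms by (simp add: follows_def anchored_def)

text \<open>Since the current anchor was set, a single strategy has been obeyed. The piece played so
  far is therefore the beginning of a full play of that strategy.\<close>

lemma anchored_extend:
  assumes anc: "anchored D b s n \<pi> anc" and "n \<le> m" and "legal (s (prefix (anc m) \<pi>))"
  obtains \<pi>' where "follows b (s (prefix (anc m) \<pi>)) (prefix (anc m) \<pi>) \<pi>'"
    "prefix (Suc m) \<pi>' = prefix (Suc m) \<pi>"
proof (rule follows_extend[OF assms(3), of "anc m" "Suc m" \<pi> b])
  show "anc m \<le> Suc m" using anchored_le[OF anc assms(2)] by simp
  show "\<forall>k. anc m \<le> k \<and> k < Suc m \<longrightarrow> \<pi> k \<in> M (prefix k \<pi>) \<and>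
      (turn (prefix k \<pi>) = b \<longrightarrow> \<pi> k = s (prefix (anc m) \<pi>) (prefix k \<pi>))"
  proof (intro allI impI)
    fix k assume k: "anc m \<le> k \<and> k < Suc m"
    then have "anc k = anc m" "n \<le> k"
      using anchored_const[OF anc assms(2), of k] anchored_le[OF anc assms(2)] by auto
    then show "\<pi> k \<in> M (prefix k \<pi>) \<and> (turn (prefix k \<pi>) = b \<longrightarrow> \<pi> k = s (prefix (anc m) \<pi>) (prefix k \<pi>))"
      using anc unfolding anchored_def by auto
  qed
qed

text \<open>Stops at histories shorter than \<open>h\<close> are ignored: every history is the root
  of a game of its own, and winning regions are sets of histories.\<close>

definition determined :: "('a list \<Rightarrow> bool option) \<Rightarrow> ('a word \<Rightarrow> bool) \<Rightarrow> bool" where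
  "determined st \<Phi> \<longleftrightarrow> (\<forall>h. \<exists>b. wins b (\<lambda>\<pi>. stopped_obj st \<Phi> (length h) \<pi> = b) h)"

lemma wins_decided:
  assumes "st h = Some b"
  shows "wins b (\<lambda>\<pi>. stopped_obj st \<Phi> (length h) \<pi> = b) h"
proof -
  obtain s where "legal s" using ex_legal by blast
  moreover have "stopped_obj st \<Phi> (length h) \<pi> = b" if "follows b s h \<pi>" for \<pi>
    using stopped_obj_stop[of "length h" "length h" st \<pi> b] that assms
    unfolding follows_def by (metis leD le_refl)
  ultimately show ?thesis unfolding wins_def by blast
qed


lemma wins_pred_own:
  assumes "turn h = b" "v \<in> M h" "st h = None"
    and "wins b (\<lambda>\<pi>. stopped_obj st \<Phi> (length (h @ [v])) \<pi> = b) (h @ [v])"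
  shows "wins b (\<lambda>\<pi>. stopped_obj st \<Phi> (length h) \<pi> = b) h"
proof -
  obtain s where s: "legal s" "\<And>\<pi>. follows b s (h @ [v]) \<pi> \<Longrightarrow> stopped_obj st \<Phi> (length (h @ [v])) \<pi> = b"
    using assms(4) unfolding wins_def by blast
  have "stopped_obj st \<Phi> (length h) \<pi> = b" if fol: "follows b (s(h := v)) h \<pi>" for \<pi>
  proof -
    have h: "prefix (length h) \<pi> = h" and "\<pi> (length h) = v"
      using fol assms(1) by (auto simp: follows_def)
    then have "prefix (length (h @ [v])) \<pi> = h @ [v]" by simp
    moreover have "prefix m \<pi> \<noteq> h" if "m \<ge> length (h @ [v])" for m
      using that by (metis Suc_eq_plus1 diff_zero length_append_singleton not_less_eq_eq order_refl subsequence_length)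
    ultimately have "follows b s (h @ [v]) \<pi>"
      using fol by (simp add: follows_def)
    moreover have "stopped_obj st \<Phi> (length h) \<pi> = stopped_obj st \<Phi> (length (h @ [v])) \<pi>"
      using h assms(3) by (intro stopped_obj_shift) (auto simp: le_less_Suc_eq)
    ultimately show ?thesis using s(2) by simp
  qed
  moreover have "legal (s(h := v))" using s(1) assms(2) by (simp add: legal_def)
  ultimately show ?thesis unfolding wins_def by blast
qed

lemma wins_pred_other:
  assumes "turn h \<noteq> b" "st h = None"
    and "\<And>v. v \<in> M h \<Longrightarrow> wins b (\<lambda>\<pi>. stopped_obj st \<Phi> (length (h @ [v])) \<pi> = b) (h @ [v])"
  shows "wins b (\<lambda>\<pi>. stopped_obj st \<Phi> (length h) \<pi> = b) h"
proof -
  have "\<forall>v. \<exists>s. legal s \<and> (v \<in> M h \<longrightarrow> (\<forall>\<pi>. follows b s (h @ [v]) \<pi> \<longrightarrow> stopped_obj st \<Phi> (length (h @ [v])) \<pi> = b))"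
    using assms(3) ex_legal unfolding wins_def by blast
  then obtain s where s: "\<And>v. legal (s v)"
    "\<And>v \<pi>. v \<in> M h \<Longrightarrow> follows b (s v) (h @ [v]) \<pi> \<Longrightarrow> stopped_obj st \<Phi> (length (h @ [v])) \<pi> = b"
    by metis
  \<comment> \<open>The opponent's move at \<open>h\<close> is read off the history. At
    \<open>h\<close> itself the index is out of range, which is harmless: \<open>b\<close> does not
    move there and every \<open>s v\<close> is legal.\<close>
  define S where "S g = s (g ! length h) g" for g
  have "stopped_obj st \<Phi> (length h) \<pi> = b" if fol: "follows b S h \<pi>" for \<pi>
  proof -
    define v where "v = \<pi> (length h)"
    have h: "prefix (length h) \<pi> = h" and v: "v \<in> M h"
      using fol by (force simp: follows_def v_def)+
    have "prefix (length (h @ [v])) \<pi> = h @ [v]" using h by (simp add: v_def)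
    moreover have "S (prefix m \<pi>) = s v (prefix m \<pi>)" if "m \<ge> length (h @ [v])" for m
      using that by (simp add: S_def v_def)
    ultimately have "follows b (s v) (h @ [v]) \<pi>"
      using fol by (simp add: follows_def)
    moreover have "stopped_obj st \<Phi> (length h) \<pi> = stopped_obj st \<Phi> (length (h @ [v])) \<pi>"
      using h assms(2) by (intro stopped_obj_shift) (auto simp: le_less_Suc_eq)
    ultimately show ?thesis using s(2) v by simp
  qed
  moreover have "legal S" using s(1) by (simp add: legal_def S_def)
  ultimately show ?thesis unfolding wins_def by blast
qed

end

text \<open>Player \<open>c\<close> gains from infinitely many visits to \<open>H\<close>.
  \<open>U\<close> is the opponent's winning region in the given game. The auxiliary map
  \<open>st'\<close> counts entering \<open>U\<close> as lost for \<open>c\<close>, and any visit to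
  \<open>H\<close> outside \<open>U\<close> as won, because from there \<open>c\<close> can start
  anew.\<close>

locale buchi_step = tree_game +
  fixes st :: "'a list \<Rightarrow> bool option" and \<Phi> \<Phi>' :: "'a word \<Rightarrow> bool"
    and H :: "'a list set" and c :: bool and U :: "'a list set" and st' :: "'a list \<Rightarrow> bool option"
  assumes \<Phi>'_inf: "\<exists>\<^sub>\<infinity>n. prefix n \<pi> \<in> H \<Longrightarrow> \<Phi>' \<pi> = c"
    and \<Phi>'_fin: "\<not> (\<exists>\<^sub>\<infinity>n. prefix n \<pi> \<in> H) \<Longrightarrow> \<Phi>' \<pi> = \<Phi> \<pi>"
    and U_def: "U = {h. wins (\<not> c) (\<lambda>\<pi>. stopped_obj st \<Phi>' (length h) \<pi> = (\<not> c)) h}"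
    and st'_def: "st' = (\<lambda>h. if h \<in> U then Some (\<not> c) else if h \<in> H \<or> st h \<noteq> None then Some c else None)"
begin

text \<open>A stop in favour of the opponent is won by the opponent on the spot, hence lies in
  \<open>U\<close>.\<close>

lemma stop_outside: "h \<notin> U \<Longrightarrow> st h = Some d \<Longrightarrow> d = c"
  using wins_decided[of st h "\<not> c" \<Phi>'] U_def by (cases "d = c") auto

text \<open>A player \<open>\<not> c\<close> who wins the auxiliary game switches to a winning strategy of the original game
  on entering \<open>U\<close>; until then neither \<open>H\<close> nor a stop is visited.\<close>

lemma opponent_wins:
  assumes "wins (\<not> c) (\<lambda>\<pi>. stopped_obj st' \<Phi> (length h) \<pi> = (\<not> c)) h"
  shows "h \<in> U"
proof (rule ccontr)
  assume hU: "h \<notin> U"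
  let ?n = "length h" and ?b = "\<not> c"
  obtain s0 where s0: "legal s0" "\<And>\<pi>. follows ?b s0 h \<pi> \<Longrightarrow> stopped_obj st' \<Phi> ?n \<pi> = ?b"
    using assms unfolding wins_def by blast
  have "\<forall>u. \<exists>s. legal s \<and> (u \<in> U \<longrightarrow> (\<forall>\<pi>. follows ?b s u \<pi> \<longrightarrow> stopped_obj st \<Phi>' (length u) \<pi> = ?b))"
    using ex_legal unfolding U_def wins_def by blast
  then obtain sU where sU: "\<And>u. legal (sU u)"
    "\<And>u \<pi>. u \<in> U \<Longrightarrow> follows ?b (sU u) u \<pi> \<Longrightarrow> stopped_obj st \<Phi>' (length u) \<pi> = ?b"
    by metis
  define s where "s a = (if a = h then s0 else sU a)" for a
  \<comment> \<open>Only the anchor \<open>h\<close> can be given up, so the switch happens at most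
    once.\<close>
  define D where "D a g \<longleftrightarrow> a = h \<and> g \<in> U" for a g
  have leg: "legal (s a)" for a using s0 sU by (simp add: s_def)
  obtain S where S: "legal S" "\<And>\<pi>. follows ?b S h \<pi> \<Longrightarrow> \<exists>anc. anchored D ?b s ?n \<pi> anc"
    using anchor_glue[of s ?b h D] leg by blast
  have "stopped_obj st \<Phi>' ?n \<pi> = ?b" if fol: "follows ?b S h \<pi>" for \<pi>
  proof -
    have h: "prefix ?n \<pi> = h" using fol by (simp add: follows_def)
    obtain anc where anc: "anchored D ?b s ?n \<pi> anc" using S fol by blast
    have ancS: "anc (Suc m) = (if prefix (anc m) \<pi> = h \<and> prefix (Suc m) \<pi> \<in> U then Suc m else anc m)"
      if "m \<ge> ?n" for m using anc that by (simp add: anchored_def D_def del: subseq_to_Suc)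
    have still: "anc m = ?n" if "?n \<le> m" "\<forall>k. ?n < k \<and> k \<le> m \<longrightarrow> prefix k \<pi> \<notin> U" for m
      using that
    proof (induction m rule: dec_induct)
      case base
      then show ?case using anc by (simp add: anchored_def)
    next
      case (step m)
      then show ?case using ancS[of m] by (auto simp del: subseq_to_Suc)
    qed
    \<comment> \<open>Otherwise the first \<open>st'\<close>-stop up to \<open>m\<close> would be
      \<open>Some c\<close>. Only \<open>s0\<close> has been used up to there, so completing the
      piece to a play of \<open>s0\<close> contradicts that \<open>s0\<close> wins.\<close>
    have quiet: "st (prefix m \<pi>) = None \<and> prefix m \<pi> \<notin> H"
      if m: "?n \<le> m" "\<forall>k. ?n < k \<and> k \<le> m \<longrightarrow> prefix k \<pi> \<notin> U" for m
    proof (rule ccontr)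
      assume bad: "\<not> ?thesis"
      have notU: "prefix k \<pi> \<notin> U" if "?n \<le> k" "k \<le> m" for k
        using that m hU h by (cases "k = ?n") auto
      have "st' (prefix m \<pi>) \<noteq> None"
        using bad notU[OF m(1)] by (auto simp: st'_def)
      then have "\<exists>k\<ge>?n. st' (prefix k \<pi>) \<noteq> None" using m(1) by blast
      then obtain k where k: "?n \<le> k" "st' (prefix k \<pi>) \<noteq> None"
        "\<forall>j. ?n \<le> j \<and> j < k \<longrightarrow> \<not> st' (prefix j \<pi>) \<noteq> None"
        by (rule first_stop)
      have "k \<le> m" using k(3) bad m(1) notU[of m] by (force simp: st'_def not_le[symmetric])
      then have stk: "st' (prefix k \<pi>) = Some c"
        using k notU[of k] by (auto simp: st'_def split: if_splits)
      have "anc k = ?n" using still[of k] k(1) m(2) \<open>k \<le> m\<close> by auto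
      then obtain \<pi>' where p: "follows ?b s0 h \<pi>'" "prefix (Suc k) \<pi>' = prefix (Suc k) \<pi>"
        using anchored_extend[OF anc k(1) leg] h by (auto simp: s_def)
      have eq: "prefix j \<pi>' = prefix j \<pi>" if "j \<le> k" for j
        using prefix_eq_le[OF p(2), of j] that by simp
      have "stopped_obj st' \<Phi> ?n \<pi>' = c"
        using stopped_obj_stop[of ?n k st' \<pi>' c] k stk eq by auto
      then show False using s0(2)[OF p(1)] by simp
    qed
    show ?thesis
    proof (cases "\<exists>m\<ge>?n. prefix m \<pi> \<in> U")
      case True
      then obtain m where m: "?n \<le> m" "prefix m \<pi> \<in> U" "\<forall>k. ?n \<le> k \<and> k < m \<longrightarrow> prefix k \<pi> \<notin> U"
        by (rule first_stop)
      then have "?n < m" using hU h by (cases "m = ?n") auto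
      then obtain j where j: "m = Suc j" "?n \<le> j" by (cases m) auto
      have "anc j = ?n" using still[of j] m(3) j by auto
      then have "anc m = m" using ancS[of j] j h m(2) by simp
      have "prefix k \<pi> \<noteq> h" if "k \<ge> m" for k
        using that \<open>?n < m\<close> by (metis diff_zero leD subsequence_length)
      have "\<forall>k\<ge>m. anc k = m"
      proof (intro allI impI)
        fix k assume "m \<le> k"
        then show "anc k = m"
        proof (induction k rule: dec_induct)
          case (step k)
          then show ?case using ancS[of k] \<open>?n < m\<close> \<open>\<And>k. k \<ge> m \<Longrightarrow> prefix k \<pi> \<noteq> h\<close>[of m] by simp
        qed (rule \<open>anc m = m\<close>)
      qed
      then have "follows ?b (s (prefix m \<pi>)) (prefix m \<pi>) \<pi>"
        using anchored_follows[OF anc m(1)] by blast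
      moreover have "s (prefix m \<pi>) = sU (prefix m \<pi>)"
        using \<open>\<And>k. k \<ge> m \<Longrightarrow> prefix k \<pi> \<noteq> h\<close>[of m] by (simp add: s_def)
      ultimately have "stopped_obj st \<Phi>' m \<pi> = ?b" using sU(2)[OF m(2)] by simp
      moreover have "stopped_obj st \<Phi>' ?n \<pi> = stopped_obj st \<Phi>' m \<pi>"
        using m quiet by (intro stopped_obj_shift) auto
      ultimately show ?thesis by simp
    next
      case False
      then have "\<forall>m\<ge>?n. anc m = ?n" using still by auto
      then have "follows ?b s0 h \<pi>" using anchored_follows[OF anc, of ?n] h by (simp add: s_def)
      then have "stopped_obj st' \<Phi> ?n \<pi> = ?b" by (rule s0(2))
      moreover have q: "\<forall>m\<ge>?n. st (prefix m \<pi>) = None \<and> prefix m \<pi> \<notin> H \<and> prefix m \<pi> \<notin> U"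
        using quiet False by simp
      then have "\<not> (\<exists>\<^sub>\<infinity>n. prefix n \<pi> \<in> H)" by (metis INFM_nat_le)
      moreover have "stopped_obj st' \<Phi> ?n \<pi> = \<Phi> \<pi>"
        using q by (intro stopped_obj_none) (simp add: st'_def)
      moreover have "stopped_obj st \<Phi>' ?n \<pi> = \<Phi>' \<pi>"
        using q by (intro stopped_obj_none) simp
      ultimately show ?thesis using \<Phi>'_fin by simp
    qed
  qed
  then have "h \<in> U" using S(1) unfolding U_def wins_def by blast
  then show False using hU by simp
qed

text \<open>If \<open>c\<close> moves and every move entered \<open>U\<close>, or the opponent moves
  and some move did, then \<open>h\<close> would lie in \<open>U\<close> by the two one-step lemmas.
  A move is returned in both cases, to be prescribed at \<open>h\<close>.\<close>

lemma ex_stay_move: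
  assumes "h \<notin> U" "st h = None"
  shows "\<exists>v\<in>M h. (if turn h = c then h @ [v] \<notin> U else \<forall>v\<in>M h. h @ [v] \<notin> U)"
proof (cases "turn h = c")
  case True
  then show ?thesis
    using wins_pred_other[of h "\<not> c" st \<Phi>'] assms unfolding U_def by auto
next
  case False
  then show ?thesis
    using wins_pred_own[of h "\<not> c" _ st \<Phi>'] assms moves_nonempty[of h] unfolding U_def by auto
qed

text \<open>Outside \<open>U\<close>, player \<open>c\<close> restarts a strategy for the auxiliary game at every visit to \<open>H\<close>,
  taking one move that stays outside \<open>U\<close> in between.\<close>

lemma player_wins:
  assumes det: "determined st' \<Phi>" and hU: "h \<notin> U"
  shows "wins c (\<lambda>\<pi>. stopped_obj st \<Phi>' (length h) \<pi> = c) h"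
proof -
  let ?n = "length h"
  have aux: "wins c (\<lambda>\<pi>. stopped_obj st' \<Phi> (length a) \<pi> = c) a" if "a \<notin> U" for a
  proof -
    obtain b where b: "wins b (\<lambda>\<pi>. stopped_obj st' \<Phi> (length a) \<pi> = b) a"
      using det unfolding determined_def by blast
    have "b = c"
    proof (rule ccontr)
      assume "b \<noteq> c"
      then have "b = (\<not> c)" by simp
      then show False using opponent_wins[of a] b that by blast
    qed
    then show ?thesis using b by simp
  qed
  \<comment> \<open>An anchor in \<open>H\<close> is already a stop of the auxiliary game, so
    winning that game from there says nothing about later moves. Such an anchor lasts one move, and
    \<open>s a\<close> only has to stay outside \<open>U\<close>.\<close>
  have "\<exists>s. legal s \<and> (a \<notin> U \<and> a \<notin> H \<longrightarrow> (\<forall>\<pi>. follows c s a \<pi> \<longrightarrow> stopped_obj st' \<Phi> (length a) \<pi> = c))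
      \<and> (a \<notin> U \<and> a \<in> H \<and> st a = None \<longrightarrow> (\<forall>v\<in>M a. (turn a = c \<longrightarrow> v = s a) \<longrightarrow> a @ [v] \<notin> U))" for a
  proof (cases "a \<notin> U \<and> a \<in> H \<and> st a = None")
    case True
    then obtain v where v: "v \<in> M a" "if turn a = c then a @ [v] \<notin> U else \<forall>v\<in>M a. a @ [v] \<notin> U"
      using ex_stay_move by blast
    obtain s where "legal s" using ex_legal by blast
    then have "legal (s(a := v))" using v by (simp add: legal_def)
    moreover have "\<forall>w\<in>M a. (turn a = c \<longrightarrow> w = (s(a := v)) a) \<longrightarrow> a @ [w] \<notin> U"
      using v by (cases "turn a = c") auto
    ultimately show ?thesis using True by blast
  next
    case False
    then show ?thesis using aux[of a] ex_legal unfolding wins_def by blast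
  qed
  then obtain s where leg: "\<And>a. legal (s a)"
    and win: "\<And>a \<pi>. a \<notin> U \<Longrightarrow> a \<notin> H \<Longrightarrow> follows c (s a) a \<pi> \<Longrightarrow> stopped_obj st' \<Phi> (length a) \<pi> = c"
    and stay: "\<And>a v. a \<notin> U \<Longrightarrow> a \<in> H \<Longrightarrow> st a = None \<Longrightarrow> v \<in> M a \<Longrightarrow> (turn a = c \<Longrightarrow> v = s a a) \<Longrightarrow> a @ [v] \<notin> U"
    by metis
  \<comment> \<open>The second disjunct ends the one-move anchor set by a visit to
    \<open>H\<close>.\<close>
  define D where "D a g \<longleftrightarrow> g \<in> H \<or> butlast g \<in> H" for a g :: "'a list"
  obtain S where S: "legal S" "\<And>\<pi>. follows c S h \<pi> \<Longrightarrow> \<exists>anc. anchored D c s ?n \<pi> anc"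
    using anchor_glue[of s c h D] leg by blast
  have "stopped_obj st \<Phi>' ?n \<pi> = c" if fol: "follows c S h \<pi>" for \<pi>
  proof -
    have h: "prefix ?n \<pi> = h" using fol by (simp add: follows_def)
    obtain anc where anc: "anchored D c s ?n \<pi> anc" using S fol by blast
    have ancS: "anc (Suc m) = (if prefix (Suc m) \<pi> \<in> H \<or> prefix m \<pi> \<in> H then Suc m else anc m)"
      if "m \<ge> ?n" for m using anc that by (simp add: anchored_def D_def)
    \<comment> \<open>The whole stretch since the current anchor must lie outside \<open>U\<close>,
      hence the strong induction. If the anchor is not in \<open>H\<close>, no auxiliary stop occurs
      on that stretch, so at \<open>m\<close> a first stop for the opponent would contradict the
      auxiliary win.\<close>
    have outside: "prefix m \<pi> \<notin> U"
      if "?n \<le> m" "\<forall>k. ?n \<le> k \<and> k < m \<longrightarrow> st (prefix k \<pi>) = None" for m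
      using that
    proof (induction m rule: less_induct)
      case (less m)
      show ?case
      proof (cases "m = ?n")
        case True
        then show ?thesis using hU h by simp
      next
        case False
        then obtain j where j: "m = Suc j" "?n \<le> j"
          using less.prems(1) by (cases m) auto
        define a where "a = anc j"
        have a: "?n \<le> a" "a \<le> j" using anchored_le[OF anc j(2)] by (simp_all add: a_def)
        have notU: "prefix k \<pi> \<notin> U" if "?n \<le> k" "k < m" for k
          using less.IH[of k] less.prems that by auto
        have stN: "st (prefix k \<pi>) = None" if "?n \<le> k" "k < m" for k
          using less.prems that by auto
        have const: "anc k = a" if "a \<le> k" "k \<le> j" for k
          using anchored_const[OF anc j(2), of k] that by (simp add: a_def)
        have noH: "prefix k \<pi> \<notin> H" if "a < k" "k \<le> j" for k
        proof
          assume "prefix k \<pi> \<in> H"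
          moreover obtain i where i: "k = Suc i" "a \<le> i"
            using \<open>a < k\<close> by (cases k) auto
          ultimately have "anc k = k" using ancS[of i] a(1) by simp
          then show False using const[of k] that by simp
        qed
        show ?thesis
        proof (cases "prefix a \<pi> \<in> H")
          case True
          have "a = j"
          proof (rule ccontr)
            assume "a \<noteq> j"
            then have "anc (Suc a) = a" using const[of "Suc a"] a by simp
            then show False using ancS[OF a(1)] True by simp
          qed
          have "\<pi> a \<in> M (prefix a \<pi>)" "turn (prefix a \<pi>) = c \<longrightarrow> \<pi> a = s (prefix a \<pi>) (prefix a \<pi>)"
            using anc a(1) const[of a] a(2) unfolding anchored_def by auto
          then have "prefix a \<pi> @ [\<pi> a] \<notin> U"
            using stay[of "prefix a \<pi>" "\<pi> a"] True notU[of a] stN[of a] a j \<open>a = j\<close> by auto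
          then show ?thesis using j \<open>a = j\<close> by simp
        next
          case False
          obtain \<pi>' where p: "follows c (s (prefix a \<pi>)) (prefix a \<pi>) \<pi>'" "prefix m \<pi>' = prefix m \<pi>"
            using anchored_extend[OF anc j(2) leg] unfolding a_def j(1) by blast
          have eq: "prefix k \<pi>' = prefix k \<pi>" if "k \<le> m" for k
            using prefix_eq_le[OF p(2), of k] that by simp
          have "stopped_obj st' \<Phi> a \<pi>' = c"
            using win[OF _ False p(1)] notU[of a] a j by simp
          moreover have "st' (prefix k \<pi>') = None" if "a \<le> k" "k < m" for k
            using that eq[of k] notU[of k] stN[of k] noH[of k] False a j by (cases "k = a") (auto simp: st'_def)
          ultimately have "st' (prefix m \<pi>') \<noteq> Some (\<not> c)"
            using stopped_obj_stop[of a m st' \<pi>' "\<not> c"] a j by auto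
          then show ?thesis using eq[of m] by (auto simp: st'_def)
        qed
      qed
    qed
    show ?thesis
    proof (rule stopped_obj_cases)
      fix m d assume "?n \<le> m" "st (prefix m \<pi>) = Some d"
        "\<forall>k. ?n \<le> k \<and> k < m \<longrightarrow> st (prefix k \<pi>) = None"
      then show "d = c" using outside[of m] stop_outside by blast
    next
      assume never: "\<forall>m\<ge>?n. st (prefix m \<pi>) = None"
      then have notU: "prefix m \<pi> \<notin> U" if "?n \<le> m" for m using outside that by simp
      show "\<Phi>' \<pi> = c"
      proof (cases "\<exists>\<^sub>\<infinity>m. prefix m \<pi> \<in> H")
        case True
        then show ?thesis by (rule \<Phi>'_inf)
      next
        case False
        then obtain N where N: "\<And>m. m \<ge> N \<Longrightarrow> prefix m \<pi> \<notin> H" by (auto simp: INFM_nat_le)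
        define K where "K = max N ?n"
        define a where "a = anc K"
        have a: "?n \<le> a" "a \<le> K" using anchored_le[OF anc, of K] by (simp_all add: a_def K_def)
        have const: "anc m = a" if "K \<le> m" for m
          using that
        proof (induction m rule: dec_induct)
          case (step m)
          then show ?case using ancS[of m] N[of m] N[of "Suc m"] by (simp add: K_def del: subseq_to_Suc)
        qed (simp add: a_def)
        have const': "\<forall>m\<ge>a. anc m = a"
        proof (intro allI impI)
          fix m assume "a \<le> m"
          then show "anc m = a"
            using anchored_const[OF anc, of K m] const[of m] by (cases "K \<le> m") (auto simp: a_def K_def)
        qed
        \<comment> \<open>A visit at time \<open>m\<close> would move the anchor to
          \<open>Suc m\<close>; so \<open>H\<close> is avoided from \<open>a\<close> on, not merely
          from \<open>K\<close> on.\<close>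
        have noH: "prefix m \<pi> \<notin> H" if "a \<le> m" for m
          using ancS[of m] const' a that by (metis le_SucI le_trans not_less_eq_eq order_refl)
        have "stopped_obj st' \<Phi> a \<pi> = c"
          using win[of "prefix a \<pi>" \<pi>] anchored_follows[OF anc a(1) const'] notU[OF a(1)] noH[of a] by simp
        moreover have "stopped_obj st' \<Phi> a \<pi> = \<Phi> \<pi>"
          using noH never notU a by (intro stopped_obj_none) (simp add: st'_def)
        ultimately show ?thesis using \<Phi>'_fin[OF False] by simp
      qed
    qed
  qed
  then show ?thesis using S(1) unfolding wins_def by blast
qed

end

context tree_game
begin

text \<open>The premise is confined to maps that decide every history in \<open>H\<close>. The
  auxiliary map of \<open>buchi_step\<close> is one of them.\<close>

lemma determined_step:
  assumes "\<And>st. \<forall>h\<in>H. st h \<noteq> None \<Longrightarrow> determined st \<Phi>"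
  shows "determined st (\<lambda>\<pi>. if \<exists>\<^sub>\<infinity>n. prefix n \<pi> \<in> H then c else \<Phi> \<pi>)" (is "determined st ?\<Phi>'")
proof -
  define U where "U = {h. wins (\<not> c) (\<lambda>\<pi>. stopped_obj st ?\<Phi>' (length h) \<pi> = (\<not> c)) h}"
  define st' where
    "st' = (\<lambda>h. if h \<in> U then Some (\<not> c) else if h \<in> H \<or> st h \<noteq> None then Some c else None)"
  interpret buchi_step M turn st \<Phi> ?\<Phi>' H c U st'
    by unfold_locales (simp_all only: U_def st'_def if_True if_False not_False_eq_True)
  have "determined st' \<Phi>"
    by (rule assms) (auto simp: st'_def)
  then have *: "h \<notin> U \<Longrightarrow> wins c (\<lambda>\<pi>. stopped_obj st ?\<Phi>' (length h) \<pi> = c) h" for h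
    by (rule player_wins)
  show ?thesis
    unfolding determined_def
  proof
    fix h show "\<exists>b. wins b (\<lambda>\<pi>. stopped_obj st ?\<Phi>' (length h) \<pi> = b) h"
    proof (cases "h \<in> U")
      case True
      then show ?thesis unfolding U_def mem_Collect_eq by (rule exI)
    next
      case False
      from *[OF this] show ?thesis by (rule exI)
    qed
  qed
qed

end

text \<open>A parity condition with priorities on histories: earlier sets take precedence, and
  \<open>d\<close> decides when no set recurs.\<close>

fun first_inf :: "bool \<Rightarrow> ('a list set \<times> bool) list \<Rightarrow> 'a word \<Rightarrow> bool" where
  "first_inf d [] \<pi> \<longleftrightarrow> d"
| "first_inf d (Hc # Hcs) \<pi> \<longleftrightarrow>
     (if \<exists>\<^sub>\<infinity>n. prefix n \<pi> \<in> fst Hc then snd Hc else first_inf d Hcs \<pi>)"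

context tree_game
begin

lemma determined_first_inf: "determined st (first_inf d Hcs)"
proof (induction Hcs arbitrary: st)
  case Nil
  \<comment> \<open>A constant objective with arbitrary stops is still a reachability game. It is
    obtained from the step with \<open>H = UNIV\<close>, whose premise then concerns only maps that
    stop everywhere.\<close>
  have "determined st (\<lambda>\<pi>. if \<exists>\<^sub>\<infinity>n. prefix n \<pi> \<in> UNIV then d else d)"
  proof (rule determined_step)
    fix st :: "'a list \<Rightarrow> bool option" assume "\<forall>h\<in>UNIV. st h \<noteq> None"
    then show "determined st (\<lambda>_. d)"
      unfolding determined_def using wins_decided by (metis UNIV_I not_None_eq)
  qed
  moreover have "(\<lambda>\<pi>. if \<exists>\<^sub>\<infinity>n. prefix n \<pi> \<in> UNIV then d else d) = first_inf d []"
    by (rule ext) (simp only: first_inf.simps if_cancel)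
  ultimately show ?case by metis
next
  case (Cons Hc Hcs)
  show ?case
    using determined_step[of "fst Hc" "first_inf d Hcs" st "snd Hc"] Cons.IH by simp
qed

theorem first_inf_determined: "\<exists>b. wins b (\<lambda>\<pi>. first_inf d Hcs \<pi> = b) h"
proof -
  have "stopped_obj (\<lambda>_. None) \<Phi> n \<pi> = \<Phi> \<pi>" for \<Phi> n and \<pi> :: "'a word"
    by (rule stopped_obj_none) simp
  then show ?thesis
    using determined_first_inf[of "\<lambda>_. None" d Hcs] by (simp add: determined_def)
qed

end

subsection \<open>Tail-invariant recognizable languages\<close>

lemma iter_append_rotate:
  assumes "p @ q \<noteq> []"
  shows "(p @ q)\<^sup>\<omega> = p \<frown> (q @ p)\<^sup>\<omega>"
proof
  fix n
  let ?l = "length p + length q"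
  have l: "?l > 0" using assms by auto
  show "(p @ q)\<^sup>\<omega> n = (p \<frown> (q @ p)\<^sup>\<omega>) n"
  proof (cases "n < length p")
    case True
    then show ?thesis using l by (simp add: nth_append)
  next
    case False
    define k where "k = n - length p"
    have n: "n = length p + k" using False by (simp add: k_def)
    have rhs: "(p \<frown> (q @ p)\<^sup>\<omega>) n = (q @ p) ! (k mod ?l)"
      using l by (simp add: n add.commute)
    have "(p @ q) ! (n mod ?l) = (q @ p) ! (k mod ?l)"
    proof (cases "k mod ?l < length q")
      case True
      then have "n mod ?l = length p + k mod ?l"
        unfolding n by (metis add.commute mod_add_right_eq mod_less nat_add_left_cancel_less)
      then show ?thesis using True by (simp add: nth_append)
    next
      case False
      define j where "j = k mod ?l - length q"
      have j: "k mod ?l = length q + j" "j < length p"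
        using False mod_less_divisor[OF l, of k] by (auto simp: j_def)
      have "n mod ?l = (length p + (length q + j)) mod ?l"
        unfolding n by (metis j(1) mod_add_right_eq)
      also have "\<dots> = j" using j(2) by (simp add: add.assoc[symmetric])
      finally show ?thesis using j by (simp add: nth_append)
    qed
    then show ?thesis using l rhs by simp
  qed
qed

lemma iter_block:
  assumes "x \<noteq> []"
  shows "x\<^sup>\<omega> [n * length x \<rightarrow> Suc n * length x] = x"
  using assms by (intro nth_equalityI) simp_all

lemma strict_mono_mult_length: "x \<noteq> [] \<Longrightarrow> strict_mono (\<lambda>n. n * length x)"
  by (simp add: strict_mono_def)

text \<open>Ramsey's theorem for pairs, each pair of positions being coloured by the value of the
  factor between them; \<open>f\<close> numbers the values because \<open>Ramsey2\<close> takes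
  colours below a bound.\<close>

lemma additive_ramsey:
  fixes \<phi> :: "'a list \<Rightarrow> 's"
  assumes "finite (range \<phi>)"
  obtains c :: "nat \<Rightarrow> nat" and e where "strict_mono c" "\<And>i j. i < j \<Longrightarrow> \<phi> (w [c i \<rightarrow> c j]) = e"
proof -
  obtain N f where f: "f ` range \<phi> = {i::nat. i < N}" "inj_on f (range \<phi>)"
    using finite_imp_inj_to_nat_seg[OF assms] by blast
  define col where "col X = f (\<phi> (w [Min X \<rightarrow> Max X]))" for X :: "nat set"
  have "col X < N" for X using f(1) by (auto simp: col_def)
  then obtain Y t where Y: "infinite Y" "\<forall>x\<in>Y. \<forall>y\<in>Y. x \<noteq> y \<longrightarrow> col {x, y} = t"
    using Ramsey2[of "UNIV :: nat set" col N] infinite_UNIV_nat by blast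
  define c where "c = enumerate Y"
  have c: "strict_mono c" "\<And>i. c i \<in> Y"
    using Y(1) by (simp_all add: c_def strict_mono_enumerate enumerate_in_set)
  have "\<phi> (w [c i \<rightarrow> c j]) = inv_into (range \<phi>) f t" if "i < j" for i j
  proof -
    have lt: "c i < c j" using c(1) that by (simp add: strict_mono_def)
    then have "c i \<noteq> c j" by simp
    then have "col {c i, c j} = t" using Y(2) c(2)[of i] c(2)[of j] by blast
    then have "f (\<phi> (w [c i \<rightarrow> c j])) = t" using lt by (simp add: col_def)
    then show ?thesis using inv_into_f_f[OF f(2), of "\<phi> (w [c i \<rightarrow> c j])"] by simp
  qed
  with c(1) show thesis by (rule that)
qed

text \<open>By \<open>cong\<close>, concatenation makes the range of \<open>\<phi>\<close> a finite
  semigroup. \<open>saturated\<close> is recognition of an omega-language by it; the two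
  factorizations may begin anywhere, since by \<open>tail\<close> the parts before
  \<open>c 0\<close> and \<open>c' 0\<close> do not affect membership.\<close>

locale tail_recognition =
  fixes \<phi> :: "'a list \<Rightarrow> 's" and W :: "'a word set"
  assumes finite_range: "finite (range \<phi>)"
    and cong: "\<phi> u = \<phi> u' \<Longrightarrow> \<phi> v = \<phi> v' \<Longrightarrow> \<phi> (u @ v) = \<phi> (u' @ v')"
    and tail: "u \<frown> x \<in> W \<longleftrightarrow> x \<in> W"
    and saturated: "strict_mono c \<Longrightarrow> strict_mono c' \<Longrightarrow>
      (\<And>n. \<phi> (w [c n \<rightarrow> c (Suc n)]) = \<phi> (w' [c' n \<rightarrow> c' (Suc n)])) \<Longrightarrow> w \<in> W \<Longrightarrow> w' \<in> W"
begin

lemma context_cong: "\<phi> u = \<phi> v \<Longrightarrow> \<phi> (a @ u @ b) = \<phi> (a @ v @ b)"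
  by (intro cong refl)

lemma blocks_iter:
  assumes "strict_mono c" "\<And>n. \<phi> (w [c n \<rightarrow> c (Suc n)]) = \<phi> x" "x \<noteq> []"
  shows "w \<in> W \<longleftrightarrow> x\<^sup>\<omega> \<in> W"
  using saturated[of c "\<lambda>n. n * length x" w "x\<^sup>\<omega>"] saturated[of "\<lambda>n. n * length x" c "x\<^sup>\<omega>" w]
    assms strict_mono_mult_length[OF assms(3)] iter_block[OF assms(3)] by auto

lemma iter_cong:
  assumes "\<phi> x = \<phi> y" "x \<noteq> []" "y \<noteq> []"
  shows "x\<^sup>\<omega> \<in> W \<longleftrightarrow> y\<^sup>\<omega> \<in> W"
  using blocks_iter[of "\<lambda>n. n * length x" "x\<^sup>\<omega>" y] assms
    strict_mono_mult_length[OF assms(2)] iter_block[OF assms(2)] by auto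

text \<open>Green's J-preorder pulled back to words; \<open>a\<close> and \<open>b\<close> may be
  empty.\<close>

definition below :: "'a list \<Rightarrow> 'a list \<Rightarrow> bool" where
  "below u v \<longleftrightarrow> (\<exists>a b. \<phi> u = \<phi> (a @ v @ b))"

lemma below_cong: "\<phi> u = \<phi> u' \<Longrightarrow> \<phi> v = \<phi> v' \<Longrightarrow> below u v \<longleftrightarrow> below u' v'"
  unfolding below_def using context_cong[of v v'] by simp

lemma below_refl: "below u u"
  unfolding below_def by (metis append_Nil append_Nil2)

lemma below_trans: "below u v \<Longrightarrow> below v w \<Longrightarrow> below u w"
  unfolding below_def
proof clarify
  fix a b a' b' assume "\<phi> u = \<phi> (a @ v @ b)" "\<phi> v = \<phi> (a' @ w @ b')"
  then have "\<phi> u = \<phi> ((a @ a') @ w @ (b' @ b))"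
    using context_cong[of v "a' @ w @ b'" a b] by simp
  then show "\<exists>a b. \<phi> u = \<phi> (a @ w @ b)" by blast
qed

text \<open>If \<open>\<phi> y = c f d\<close> with \<open>f\<close> an idempotent below the idempotent \<open>y\<close>, then
  \<open>y = c (y f d) = c\<^sup>n y (f d)\<^sup>n\<close>, so \<open>y = y (f d)\<^sup>k\<close> for some \<open>k > 0\<close> by finiteness and \<open>y \<in> f S\<close>.\<close>

lemma idempotent_below_eq:
  assumes ff: "\<phi> (f @ f) = \<phi> f" and yf: "\<phi> (y @ f) = \<phi> f" and fy: "\<phi> (f @ y) = \<phi> f"
    and ycfd: "\<phi> y = \<phi> (c @ f @ d)"
  shows "\<phi> f = \<phi> y"
proof -
  define v where "v = f @ d"
  define pow where "pow n u = concat (replicate n u)" for n and u :: "'a list"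
  have pow_add: "pow (m + n) u = pow m u @ pow n u" for m n u
    by (simp add: pow_def replicate_add)
  have "\<phi> (c @ (y @ f) @ d) = \<phi> (c @ f @ d)" using yf by (rule context_cong)
  then have ycv: "\<phi> y = \<phi> (c @ y @ v)" using ycfd by (simp add: v_def)
  have iter: "\<phi> y = \<phi> (pow n c @ y @ pow n v)" for n
  proof (induction n)
    case (Suc n)
    have "\<phi> (pow n c @ y @ pow n v) = \<phi> (pow n c @ (c @ y @ v) @ pow n v)"
      using ycv by (rule context_cong)
    moreover have "pow n c @ c = pow (Suc n) c" "v @ pow n v = pow (Suc n) v"
      using pow_add[of n 1 c] pow_add[of 1 n v] by (simp_all add: pow_def)
    ultimately show ?case using Suc by (metis append.assoc)
  qed (simp add: pow_def)
  have "\<not> inj (\<lambda>n. \<phi> (pow n v))"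
    using finite_range finite_imageD[of "\<lambda>n. \<phi> (pow n v)" UNIV]
    by (metis finite_subset image_subsetI infinite_UNIV_nat rangeI)
  then obtain n m where nm: "n < m" "\<phi> (pow n v) = \<phi> (pow m v)"
    unfolding inj_def by (metis nat_neq_iff)
  then obtain k where k: "m = n + Suc k" by (metis add_Suc_right less_iff_Suc_add)
  define z where "z = d @ pow k v"
  have "\<phi> y = \<phi> ((pow n c @ y) @ pow m v @ [])"
    using iter[of n] context_cong[OF nm(2), of "pow n c @ y" "[]"] by simp
  also have "\<dots> = \<phi> ([] @ (pow n c @ y @ pow n v) @ pow (Suc k) v)"
    by (simp only: k pow_add append.assoc append_Nil append_Nil2)
  also have "\<dots> = \<phi> ([] @ y @ pow (Suc k) v)"
    using iter[of n] by (metis context_cong)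
  also have "\<dots> = \<phi> ([] @ (y @ f) @ z)"
    by (simp add: pow_def v_def z_def)
  also have "\<dots> = \<phi> ([] @ f @ z)"
    using yf by (rule context_cong)
  finally have y: "\<phi> y = \<phi> (f @ z)" by simp
  have "\<phi> f = \<phi> (f @ y)" using fy by simp
  also have "\<dots> = \<phi> (f @ (f @ z))" using y by (intro cong) simp_all
  also have "\<dots> = \<phi> (f @ z)" using cong[OF ff refl, of z] by simp
  finally show ?thesis using y by simp
qed

text \<open>Idempotents generating the same two-sided ideal are conjugate, that is, of the form \<open>p q\<close>
  and \<open>q p\<close>, and \<open>(p q)\<^sup>\<omega> = p (q p)\<^sup>\<omega>\<close>.\<close>

lemma idempotent_equiv_iter:
  assumes xx: "\<phi> (x @ x) = \<phi> x" and yy: "\<phi> (y @ y) = \<phi> y" and "x \<noteq> []" "y \<noteq> []"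
    and "below x y" "below y x"
  shows "x\<^sup>\<omega> \<in> W \<longleftrightarrow> y\<^sup>\<omega> \<in> W"
proof -
  obtain A B C D where x: "\<phi> x = \<phi> (A @ y @ B)" and y: "\<phi> y = \<phi> (C @ x @ D)"
    using assms unfolding below_def by blast
  \<comment> \<open>With this choice \<open>p @ q\<close> has the value of \<open>x\<close>, and
    \<open>f = q @ p\<close> is an idempotent on which \<open>y\<close> acts as the identity from
    both sides; \<open>idempotent_below_eq\<close> then identifies it with \<open>y\<close>.\<close>
  define p where "p = x @ A @ y"
  define q where "q = y @ B @ x"
  have pq: "\<phi> (p @ q) = \<phi> x"
  proof -
    have "\<phi> (p @ q) = \<phi> ((x @ A) @ (y @ y) @ (B @ x))" by (simp add: p_def q_def)
    also have "\<dots> = \<phi> ((x @ A) @ y @ (B @ x))" using yy by (rule context_cong)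
    also have "\<dots> = \<phi> (x @ (A @ y @ B) @ x)" by simp
    also have "\<dots> = \<phi> (x @ x @ x)" using x[symmetric] by (rule context_cong)
    also have "\<dots> = \<phi> (x @ x)" using cong[OF refl xx] .
    finally show ?thesis using xx by simp
  qed
  define f where "f = q @ p"
  have ff: "\<phi> (f @ f) = \<phi> f"
  proof -
    have "\<phi> (f @ f) = \<phi> (q @ (p @ q) @ p)" by (simp add: f_def)
    also have "\<dots> = \<phi> (q @ x @ p)" using pq by (rule context_cong)
    also have "\<dots> = \<phi> ((y @ B) @ (x @ x) @ p)" by (simp add: q_def)
    also have "\<dots> = \<phi> ((y @ B) @ x @ p)" using xx by (rule context_cong)
    finally show ?thesis by (simp add: f_def q_def)
  qed
  have yf: "\<phi> (y @ f) = \<phi> f"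
    using context_cong[OF yy, of "[]" "B @ x @ p"] by (simp add: f_def q_def)
  have fy: "\<phi> (f @ y) = \<phi> f"
    using context_cong[OF yy, of "q @ x @ A" "[]"] by (simp add: f_def p_def)
  have "\<phi> x = \<phi> ((p @ q) @ (p @ q))"
    using cong[OF pq pq] xx by simp
  then have "\<phi> (C @ x @ D) = \<phi> (C @ ((p @ q) @ (p @ q)) @ D)" by (rule context_cong)
  then have "\<phi> y = \<phi> ((C @ p) @ f @ (q @ D))" using y by (simp add: f_def)
  with ff yf fy have f: "\<phi> f = \<phi> y" by (rule idempotent_below_eq)
  have ne: "p @ q \<noteq> []" "q @ p \<noteq> []" using \<open>x \<noteq> []\<close> by (simp_all add: p_def)
  have "x\<^sup>\<omega> \<in> W \<longleftrightarrow> (p @ q)\<^sup>\<omega> \<in> W" using iter_cong[OF pq] ne \<open>x \<noteq> []\<close> by simp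
  also have "\<dots> \<longleftrightarrow> (q @ p)\<^sup>\<omega> \<in> W" using iter_append_rotate[OF ne(1)] tail by simp
  also have "\<dots> \<longleftrightarrow> y\<^sup>\<omega> \<in> W" using iter_cong[of "q @ p" y] f ne \<open>y \<noteq> []\<close> by (simp add: f_def)
  finally show ?thesis .
qed

text \<open>Histories at whose end a factor enters the ideal below \<open>v\<close> for the first time since it began.
  For every starting position this happens at most once.\<close>

definition entering :: "'a list \<Rightarrow> 'a list set" where
  "entering v = {h. \<exists>k<length h. below (drop k h) v \<and>
     (\<forall>j. k < j \<and> j < length h \<longrightarrow> \<not> below (drop k (take j h)) v)}"

lemma prefix_in_entering:
  "prefix n \<pi> \<in> entering v \<longleftrightarrow>
    (\<exists>k<n. below (\<pi> [k \<rightarrow> n]) v \<and> (\<forall>j. k < j \<and> j < n \<longrightarrow> \<not> below (\<pi> [k \<rightarrow> j]) v))"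
  by (auto simp: entering_def min_def)

text \<open>Prolonging a factor never leaves an ideal, so without the restriction to first entries
  one start would count infinitely often. With it, starts below a bound account for finitely many
  histories, while ever later starts give ever longer ones.\<close>

lemma entering_infinitely_often:
  "(\<exists>\<^sub>\<infinity>n. prefix n \<pi> \<in> entering v) \<longleftrightarrow> (\<forall>N. \<exists>i j. N \<le> i \<and> i < j \<and> below (\<pi> [i \<rightarrow> j]) v)"
proof
  assume inf: "\<exists>\<^sub>\<infinity>n. prefix n \<pi> \<in> entering v"
  show "\<forall>N. \<exists>i j. N \<le> i \<and> i < j \<and> below (\<pi> [i \<rightarrow> j]) v"
  proof (rule ccontr)
    assume "\<not> ?thesis"
    then obtain N where N: "\<And>i j. i < j \<Longrightarrow> below (\<pi> [i \<rightarrow> j]) v \<Longrightarrow> i < N"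
      by (meson not_le)
    have "{n. prefix n \<pi> \<in> entering v} \<subseteq> (\<lambda>k. LEAST j. k < j \<and> below (\<pi> [k \<rightarrow> j]) v) ` {..<N}"
    proof
      fix n assume "n \<in> {n. prefix n \<pi> \<in> entering v}"
      then obtain k where k: "k < n" "below (\<pi> [k \<rightarrow> n]) v" "\<forall>j. k < j \<and> j < n \<longrightarrow> \<not> below (\<pi> [k \<rightarrow> j]) v"
        unfolding mem_Collect_eq prefix_in_entering by blast
      then have "(LEAST j. k < j \<and> below (\<pi> [k \<rightarrow> j]) v) = n"
        by (intro Least_equality) (auto simp: not_less[symmetric])
      then show "n \<in> (\<lambda>k. LEAST j. k < j \<and> below (\<pi> [k \<rightarrow> j]) v) ` {..<N}"
        using N[OF k(1,2)] by blast
    qed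
    then show False using inf unfolding Inf_many_def by (meson finite_imageI finite_lessThan finite_subset)
  qed
next
  assume late: "\<forall>N. \<exists>i j. N \<le> i \<and> i < j \<and> below (\<pi> [i \<rightarrow> j]) v"
  show "\<exists>\<^sub>\<infinity>n. prefix n \<pi> \<in> entering v"
    unfolding INFM_nat
  proof
    fix N
    obtain i j where "N \<le> i" "i < j" "below (\<pi> [i \<rightarrow> j]) v" using late by blast
    moreover define n where "n = (LEAST j. i < j \<and> below (\<pi> [i \<rightarrow> j]) v)"
    ultimately have "i < n \<and> below (\<pi> [i \<rightarrow> n]) v" "\<forall>j. i < j \<and> j < n \<longrightarrow> \<not> below (\<pi> [i \<rightarrow> j]) v"
      using LeastI[of "\<lambda>j. i < j \<and> below (\<pi> [i \<rightarrow> j]) v" j] not_less_Least by (simp, blast)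
    then show "\<exists>n>N. prefix n \<pi> \<in> entering v"
      unfolding prefix_in_entering using \<open>N \<le> i\<close> by (metis le_less_trans)
  qed
qed

text \<open>Any factor beyond \<open>c 0\<close> lies inside some
  \<open>\<pi> [c 0 \<rightarrow> c j]\<close>, whose value is that of \<open>x\<close>. So the
  ideals entered infinitely often are exactly those containing the Ramsey value.\<close>

lemma entering_iff_below_block:
  fixes c :: "nat \<Rightarrow> nat"
  assumes c: "strict_mono c" "\<And>i j. i < j \<Longrightarrow> \<phi> (\<pi> [c i \<rightarrow> c j]) = \<phi> x"
  shows "(\<exists>\<^sub>\<infinity>n. prefix n \<pi> \<in> entering v) \<longleftrightarrow> below x v"
  unfolding entering_infinitely_often
proof
  assume "\<forall>N. \<exists>i j. N \<le> i \<and> i < j \<and> below (\<pi> [i \<rightarrow> j]) v"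
  then obtain i j where ij: "c 0 \<le> i" "i < j" "below (\<pi> [i \<rightarrow> j]) v" by blast
  have "j \<le> c j" using c(1) by (simp add: strict_mono_imp_increasing)
  then have "\<pi> [c 0 \<rightarrow> c j] = \<pi> [c 0 \<rightarrow> i] @ \<pi> [i \<rightarrow> j] @ \<pi> [j \<rightarrow> c j]"
    using ij unfolding subsequence_def
    by (metis le_trans less_imp_le map_append upt_add_eq_append le_add_diff_inverse)
  then have "below x (\<pi> [i \<rightarrow> j])" using c(2)[of 0 j] ij(2) unfolding below_def by (metis gr_zeroI less_zeroE)
  then show "below x v" using ij(3) by (rule below_trans)
next
  assume x: "below x v"
  show "\<forall>N. \<exists>i j. N \<le> i \<and> i < j \<and> below (\<pi> [i \<rightarrow> j]) v"
  proof
    fix N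
    have "N \<le> c N" "c N < c (Suc N)" using c(1) by (simp_all add: strict_mono_imp_increasing strict_mono_Suc_iff)
    moreover have "below (\<pi> [c N \<rightarrow> c (Suc N)]) v"
      using x below_cong[OF c(2)[of N "Suc N"] refl] by simp
    ultimately show "\<exists>i j. N \<le> i \<and> i < j \<and> below (\<pi> [i \<rightarrow> j]) v" by blast
  qed
qed

lemma first_inf_eqI:
  assumes "us = as @ u # bs" "\<exists>\<^sub>\<infinity>n. prefix n \<pi> \<in> X u" "\<And>v. v \<in> set as \<Longrightarrow> \<not> (\<exists>\<^sub>\<infinity>n. prefix n \<pi> \<in> X v)"
  shows "first_inf d (map (\<lambda>u. (X u, b u)) us) \<pi> \<longleftrightarrow> b u"
  using assms(3) unfolding assms(1)
proof (induction as)
  case Nil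
  then show ?case using assms(2) by simp
next
  case (Cons v as)
  have "\<not> (\<exists>\<^sub>\<infinity>n. prefix n \<pi> \<in> X v)" by (rule Cons.prems) simp
  then show ?case using Cons by (simp del: not_INFM)
qed

text \<open>\<open>us\<close> holds a representative of every value; let \<open>u0\<close> be that
  of the Ramsey block \<open>x\<close>. The first \<open>u\<close> with \<open>below x u\<close>
  does not come after \<open>u0\<close>, so its ideal is at most as large; as it contains that of
  \<open>u0\<close>, both agree, and \<open>x\<close> and \<open>u\<close> lie below each other. By
  \<open>idempotent_equiv_iter\<close>, any idempotent witnessing \<open>b u\<close> gives the same
  answer.\<close>

theorem ex_first_inf: "\<exists>Hcs. \<forall>\<pi>. \<pi> \<in> W \<longleftrightarrow> first_inf d Hcs \<pi>"
proof -
  define ideal where "ideal u = {\<phi> t |t. below t u}" for u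
  have fin: "finite (ideal u)" for u
    by (rule finite_subset[OF _ finite_range]) (auto simp: ideal_def)
  obtain ts where ts: "set ts = range \<phi>" using finite_list[OF finite_range] by blast
  define us where "us = sort_key (\<lambda>u. card (ideal u)) (map (inv \<phi>) ts)"
  have sorted: "sorted (map (\<lambda>u. card (ideal u)) us)" by (simp add: us_def)
  have reps: "\<exists>u\<in>set us. \<phi> u = \<phi> x" for x
    by (simp add: us_def ts f_inv_into_f)
  define b where
    "b u \<longleftrightarrow> (\<exists>x. x \<noteq> [] \<and> \<phi> (x @ x) = \<phi> x \<and> below x u \<and> below u x \<and> x\<^sup>\<omega> \<in> W)" for u
  have "\<pi> \<in> W \<longleftrightarrow> first_inf d (map (\<lambda>u. (entering u, b u)) us) \<pi>" for \<pi>
  proof -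
    obtain c :: "nat \<Rightarrow> nat" and e where c: "strict_mono c" "\<And>i j. i < j \<Longrightarrow> \<phi> (\<pi> [c i \<rightarrow> c j]) = e"
      using additive_ramsey[OF finite_range] by metis
    define x where "x = \<pi> [c 0 \<rightarrow> c 1]"
    have e: "e = \<phi> x" using c(2)[of 0 1] by (simp add: x_def)
    have blocks: "\<phi> (\<pi> [c i \<rightarrow> c j]) = \<phi> x" if "i < j" for i j using c(2) that e by simp
    have c012: "c 0 < c 1" "c 1 < c 2" using c(1) by (simp_all add: strict_mono_def)
    then have "x \<noteq> []" by (simp add: x_def)
    have "\<pi> [c 0 \<rightarrow> c 2] = x @ \<pi> [c 1 \<rightarrow> c 2]"
      using c012 unfolding subsequence_def x_def
      by (metis le_add_diff_inverse less_imp_le map_append upt_add_eq_append)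
    then have xx: "\<phi> (x @ x) = \<phi> x"
      using cong[OF refl blocks[of 1 2], of x] blocks[of 0 2] by simp
    have W: "\<pi> \<in> W \<longleftrightarrow> x\<^sup>\<omega> \<in> W"
      using blocks_iter[OF c(1) _ \<open>x \<noteq> []\<close>] blocks by simp
    have inf: "(\<exists>\<^sub>\<infinity>n. prefix n \<pi> \<in> entering v) \<longleftrightarrow> below x v" for v
      using entering_iff_below_block[OF c(1) blocks] .
    obtain u0 where u0: "u0 \<in> set us" "\<phi> u0 = \<phi> x" using reps by blast
    then have "below x u0" using below_refl[of x] below_cong by blast
    then obtain as u bs where us: "us = as @ u # bs" "below x u" "\<forall>v\<in>set as. \<not> below x v"
      using split_list_first_prop[of us "below x"] u0(1) by blast
    have "card (ideal u) \<le> card (ideal u0)"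
      using sorted u0(1) us \<open>below x u0\<close> by (auto simp: sorted_append)
    moreover have "ideal u0 \<subseteq> ideal u"
    proof
      fix s assume "s \<in> ideal u0"
      then obtain t where t: "s = \<phi> t" "below t u0" by (auto simp: ideal_def)
      then have "below t x" using below_cong[OF refl u0(2)] by blast
      then show "s \<in> ideal u" using below_trans us(2) t(1) by (auto simp: ideal_def)
    qed
    ultimately have "ideal u0 = ideal u" using fin card_seteq by metis
    then have "\<phi> u \<in> ideal u0" using below_refl by (auto simp: ideal_def)
    then obtain t where "\<phi> u = \<phi> t" "below t u0" by (auto simp: ideal_def)
    then have "below u x" using below_cong[of u t u0 x] below_cong[OF refl u0(2)] u0(2) by metis
    have "b u \<longleftrightarrow> x\<^sup>\<omega> \<in> W"
    proof
      assume "b u"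
      then obtain y where y: "y \<noteq> []" "\<phi> (y @ y) = \<phi> y" "below y u" "below u y" "y\<^sup>\<omega> \<in> W"
        unfolding b_def by blast
      then show "x\<^sup>\<omega> \<in> W"
        using idempotent_equiv_iter[OF xx y(2) \<open>x \<noteq> []\<close> y(1)] below_trans us(2) \<open>below u x\<close> by blast
    next
      assume "x\<^sup>\<omega> \<in> W"
      then show "b u" using xx \<open>x \<noteq> []\<close> us(2) \<open>below u x\<close> unfolding b_def by blast
    qed
    moreover have "first_inf d (map (\<lambda>u. (entering u, b u)) us) \<pi> \<longleftrightarrow> b u"
      using us inf by (intro first_inf_eqI[OF us(1)]) auto
    ultimately show ?thesis using W by simp
  qed
  then show ?thesis by blast
qed

end

subsection \<open>Profiles of Buechi automata\<close>

text \<open>The last state is excluded from the test for \<open>F\<close>, so that in a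
  concatenation each state is tested in exactly one piece.\<close>

definition profile :: "(nat \<times> 'a \<times> nat) set \<Rightarrow> nat set \<Rightarrow> 'a list \<Rightarrow> (nat \<times> bool \<times> nat) set" where
  "profile \<delta> F u = {(q, b, q'). \<exists>r. r 0 = q \<and> r (length u) = q' \<and>
     (\<forall>k<length u. (r k, u ! k, r (Suc k)) \<in> \<delta>) \<and> (b \<longleftrightarrow> (\<exists>k<length u. r k \<in> F))}"

lemma ex_less_add_iff: "(\<exists>k<m + n. P k) \<longleftrightarrow> (\<exists>k<m. P k) \<or> (\<exists>k<n. P (m + k))" for m n :: nat
proof
  assume "\<exists>k<m + n. P k"
  then obtain k where k: "k < m + n" "P k" by blast
  show "(\<exists>k<m. P k) \<or> (\<exists>k<n. P (m + k))"
  proof (cases "k < m")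
    case False
    then have "k - m < n" "P (m + (k - m))" using k by simp_all
    then show ?thesis by blast
  qed (use k in blast)
next
  assume "(\<exists>k<m. P k) \<or> (\<exists>k<n. P (m + k))"
  then show "\<exists>k<m + n. P k" by (meson nat_add_left_cancel_less trans_less_add1)
qed

lemma profile_append:
  "(q, b, q') \<in> profile \<delta> F (u @ v) \<longleftrightarrow>
    (\<exists>p b1 b2. (q, b1, p) \<in> profile \<delta> F u \<and> (p, b2, q') \<in> profile \<delta> F v \<and> b = (b1 \<or> b2))"
  (is "?l \<longleftrightarrow> ?r")
proof
  assume ?l
  then obtain r where r: "r 0 = q" "r (length u + length v) = q'"
    "\<And>k. k < length u + length v \<Longrightarrow> (r k, (u @ v) ! k, r (Suc k)) \<in> \<delta>"
    "b \<longleftrightarrow> (\<exists>k<length u + length v. r k \<in> F)"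
    by (auto simp: profile_def)
  have "(q, \<exists>k<length u. r k \<in> F, r (length u)) \<in> profile \<delta> F u"
    unfolding profile_def mem_Collect_eq case_prod_conv
  proof (intro exI[of _ r] conjI allI impI)
    fix k assume "k < length u"
    then show "(r k, u ! k, r (Suc k)) \<in> \<delta>" using r(3)[of k] by (simp add: nth_append)
  qed (use r(1) in simp_all)
  moreover have "(r (length u), \<exists>k<length v. r (length u + k) \<in> F, q') \<in> profile \<delta> F v"
    unfolding profile_def mem_Collect_eq case_prod_conv
  proof (intro exI[of _ "\<lambda>k. r (length u + k)"] conjI allI impI)
    fix k assume "k < length v"
    then show "(r (length u + k), v ! k, r (length u + Suc k)) \<in> \<delta>"
      using r(3)[of "length u + k"] by (simp add: nth_append)
  qed (use r(2) in simp_all)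
  moreover have "b \<longleftrightarrow> (\<exists>k<length u. r k \<in> F) \<or> (\<exists>k<length v. r (length u + k) \<in> F)"
    unfolding r(4) by (rule ex_less_add_iff)
  ultimately show ?r by blast
next
  assume ?r
  then obtain p b1 b2 where b: "b = (b1 \<or> b2)" "(q, b1, p) \<in> profile \<delta> F u" "(p, b2, q') \<in> profile \<delta> F v"
    by blast
  from b(2) obtain r1 where r1: "r1 0 = q" "r1 (length u) = p" "\<And>k. k < length u \<Longrightarrow> (r1 k, u ! k, r1 (Suc k)) \<in> \<delta>"
      "b1 \<longleftrightarrow> (\<exists>k<length u. r1 k \<in> F)"
    unfolding profile_def by blast
  from b(3) obtain r2 where r2: "r2 0 = p" "r2 (length v) = q'" "\<And>k. k < length v \<Longrightarrow> (r2 k, v ! k, r2 (Suc k)) \<in> \<delta>"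
      "b2 \<longleftrightarrow> (\<exists>k<length v. r2 k \<in> F)"
    unfolding profile_def by blast
  define r where "r k = (if k < length u then r1 k else r2 (k - length u))" for k
  have ru: "r k = r1 k" if "k \<le> length u" for k
    using that r1(2) r2(1) by (simp add: r_def)
  have rv: "r (length u + k) = r2 k" for k by (simp add: r_def)
  show ?l
    unfolding profile_def mem_Collect_eq case_prod_conv
  proof (intro exI[of _ r] conjI allI impI)
    show "r 0 = q" "r (length (u @ v)) = q'" using ru[of 0] rv[of "length v"] r1(1) r2(2) by simp_all
    show "b \<longleftrightarrow> (\<exists>k<length (u @ v). r k \<in> F)"
      unfolding b(1) r1(4) r2(4) length_append ex_less_add_iff rv using ru by auto
  next
    fix k assume k: "k < length (u @ v)"
    show "(r k, (u @ v) ! k, r (Suc k)) \<in> \<delta>"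
    proof (cases "k < length u")
      case True
      then show ?thesis using r1(3)[of k] ru[of k] ru[of "Suc k"] by (simp add: nth_append)
    next
      case False
      then show ?thesis using k r2(3)[of "k - length u"] rv[of "k - length u"] rv[of "Suc (k - length u)"]
        by (simp add: nth_append)
    qed
  qed
qed

lemma profile_cong:
  "profile \<delta> F u = profile \<delta> F u' \<Longrightarrow> profile \<delta> F v = profile \<delta> F v' \<Longrightarrow>
    profile \<delta> F (u @ v) = profile \<delta> F (u' @ v')"
  by (rule set_eqI) (auto simp: profile_append)

lemma finite_range_profile:
  assumes "finite Q" "\<delta> \<subseteq> Q \<times> UNIV \<times> Q"
  shows "finite (range (profile \<delta> F))"
proof (rule finite_subset)
  \<comment> \<open>The empty word is set apart: its profile is the diagonal over all numbers,
    including those outside \<open>Q\<close>.\<close>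
  show "range (profile \<delta> F) \<subseteq> insert (profile \<delta> F []) (Pow (Q \<times> UNIV \<times> Q))"
  proof
    fix X assume "X \<in> range (profile \<delta> F)"
    then obtain u where X: "X = profile \<delta> F u" by blast
    show "X \<in> insert (profile \<delta> F []) (Pow (Q \<times> UNIV \<times> Q))"
    proof (cases "u = []")
      case False
      have "q \<in> Q \<and> q' \<in> Q" if mem: "(q, b, q') \<in> X" for q b q'
      proof -
        obtain r where r: "r 0 = q" "r (length u) = q'" "\<forall>k<length u. (r k, u ! k, r (Suc k)) \<in> \<delta>"
          using mem unfolding X profile_def by blast
        obtain l where "length u = Suc l" using False by (cases u) auto
        then have "(q, u ! 0, r 1) \<in> \<delta>" "(r l, u ! l, q') \<in> \<delta>" using r by auto
        then show ?thesis using assms(2) by auto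
      qed
      then show ?thesis by auto
    qed (simp add: X)
  qed
  show "finite (insert (profile \<delta> F []) (Pow (Q \<times> (UNIV :: bool set) \<times> Q)))"
    using assms(1) by simp
qed

lemma strict_mono_block:
  assumes "strict_mono (c :: nat \<Rightarrow> nat)" "c 0 \<le> k"
  obtains n where "c n \<le> k" "k < c (Suc n)"
proof -
  let ?P = "\<lambda>n. k < c (Suc n)"
  have "?P k" using strict_mono_imp_increasing[OF assms(1), of "Suc k"] by simp
  then have P: "?P (LEAST n. ?P n)" by (rule LeastI)
  moreover have "c (LEAST n. ?P n) \<le> k"
  proof (cases "LEAST n. ?P n")
    case (Suc m)
    then have "\<not> ?P m" using not_less_Least[of m ?P] by simp
    then show ?thesis using Suc by simp
  qed (use assms(2) in simp)
  ultimately show thesis using that by blast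
qed

text \<open>Equal profiles allow each block of the accepting run to be replaced by a run over the
  other block with the same end states and the same answer about \<open>F\<close>.\<close>

lemma buchi_accepts_blocks:
  assumes c: "strict_mono c" "c 0 = 0" and c': "strict_mono c'" "c' 0 = 0"
    and blocks: "\<And>n. profile \<delta> F (w [c n \<rightarrow> c (Suc n)]) = profile \<delta> F (w' [c' n \<rightarrow> c' (Suc n)])"
    and acc: "buchi_accepts Q I \<delta> F w"
  shows "buchi_accepts Q I \<delta> F w'"
proof -
  obtain r where r: "r 0 \<in> I" "\<And>n. (r n, w n, r (Suc n)) \<in> \<delta>" "\<exists>\<^sub>\<infinity>n. r n \<in> F"
    using acc unfolding buchi_accepts_def by blast
  define l where "l n = c (Suc n) - c n" for n
  define l' where "l' n = c' (Suc n) - c' n" for n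
  have cS: "c (Suc n) = c n + l n" and c'S: "c' (Suc n) = c' n + l' n" for n
    using c(1) c'(1) by (auto simp: l_def l'_def strict_mono_Suc_iff less_imp_le)
  have "\<exists>g. g 0 = r (c n) \<and> g (l' n) = r (c (Suc n)) \<and>
      (\<forall>k<l' n. (g k, w' (c' n + k), g (Suc k)) \<in> \<delta>) \<and>
      ((\<exists>k<l n. r (c n + k) \<in> F) \<longleftrightarrow> (\<exists>k<l' n. g k \<in> F))" for n
  proof -
    have "(r (c n), \<exists>k<l n. r (c n + k) \<in> F, r (c (Suc n))) \<in> profile \<delta> F (w [c n \<rightarrow> c (Suc n)])"
      unfolding profile_def mem_Collect_eq case_prod_conv
      by (rule exI[of _ "\<lambda>k. r (c n + k)"]) (use r(2) in \<open>simp add: cS\<close>)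
    then have "(r (c n), \<exists>k<l n. r (c n + k) \<in> F, r (c (Suc n))) \<in> profile \<delta> F (w' [c' n \<rightarrow> c' (Suc n)])"
      by (simp only: blocks)
    moreover have "length (w' [c' n \<rightarrow> c' (Suc n)]) = l' n" by (simp add: l'_def)
    moreover have "w' [c' n \<rightarrow> c' (Suc n)] ! k = w' (c' n + k)" if "k < l' n" for k
      using that by (simp add: l'_def)
    ultimately show ?thesis
      unfolding profile_def mem_Collect_eq case_prod_conv by auto
  qed
  then obtain g where g: "\<And>n. g n 0 = r (c n)" "\<And>n. g n (l' n) = r (c (Suc n))"
    "\<And>n k. k < l' n \<Longrightarrow> (g n k, w' (c' n + k), g n (Suc k)) \<in> \<delta>"
    "\<And>n. (\<exists>k<l n. r (c n + k) \<in> F) \<longleftrightarrow> (\<exists>k<l' n. g n k \<in> F)"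
    by metis
  define idx where "idx k = (LEAST n. k < c' (Suc n))" for k
  define r' where "r' k = g (idx k) (k - c' (idx k))" for k
  have idx: "idx (c' n + j) = n" if "j < l' n" for n j
    unfolding idx_def
  proof (rule Least_equality)
    show "c' n + j < c' (Suc n)" using that c'S by simp
    fix m assume "c' n + j < c' (Suc m)"
    then have "c' n < c' (Suc m)" by simp
    then show "n \<le> m" using c'(1) by (simp add: strict_mono_less)
  qed
  \<comment> \<open>The case \<open>j = l' n\<close> is the seam: the next piece begins in the state
    \<open>r (c (Suc n))\<close> in which this one ends.\<close>
  have r': "r' (c' n + j) = g n j" if "j \<le> l' n" for n j
  proof (cases "j < l' n")
    case True
    then show ?thesis by (simp add: r'_def idx)
  next
    case False
    have "0 < l' (Suc n)" using c'(1) by (simp add: l'_def strict_mono_Suc_iff)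
    then have "r' (c' (Suc n)) = g (Suc n) 0" using idx[of 0 "Suc n"] by (simp add: r'_def)
    then show ?thesis using False that g(1,2) c'S by simp
  qed
  have "r' 0 = r 0" using r'[of 0 0] g(1)[of 0] c(2) c'(2) by simp
  moreover have "(r' k, w' k, r' (Suc k)) \<in> \<delta>" for k
  proof -
    obtain n where n: "c' n \<le> k" "k < c' (Suc n)"
      using strict_mono_block[OF c'(1), of k] c'(2) by auto
    define j where "j = k - c' n"
    have "k = c' n + j" "j < l' n" using n c'S[of n] by (simp_all add: j_def)
    then show ?thesis using r'[of j n] r'[of "Suc j" n] g(3)[of j n] by simp
  qed
  moreover have "\<exists>\<^sub>\<infinity>k. r' k \<in> F"
    unfolding INFM_nat_le
  proof
    fix N
    obtain k where k: "c N \<le> k" "r k \<in> F" using r(3) unfolding INFM_nat_le by blast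
    then obtain n where n: "c n \<le> k" "k < c (Suc n)"
      using strict_mono_block[OF c(1), of k] c(2) by auto
    have "c N < c (Suc n)" using k n by simp
    then have "N \<le> n" using c(1) by (simp add: strict_mono_less)
    have "\<exists>i<l n. r (c n + i) \<in> F"
      using n k cS[of n] by (intro exI[of _ "k - c n"]) auto
    then obtain j where "j < l' n" "g n j \<in> F" using g(4) by blast
    then have "r' (c' n + j) \<in> F" using r'[of j n] by simp
    moreover have "N \<le> c' n + j"
      using \<open>N \<le> n\<close> strict_mono_imp_increasing[OF c'(1), of n] by simp
    ultimately show "\<exists>k\<ge>N. r' k \<in> F" by blast
  qed
  ultimately show ?thesis unfolding buchi_accepts_def using r(1) by metis
qed

text \<open>Only the union is tail-invariant, not each \<open>X k\<close>. Hence
  \<open>\<phi>\<close> collects the profiles of all automata, and saturation is transferred through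
  whichever one accepts.\<close>

lemma omega_regular_union_recognition:
  fixes X :: "nat \<Rightarrow> 'a word set" and n :: nat
  assumes reg: "\<forall>k<n. omega_regular (X k)" and K: "K \<subseteq> {..<n}" and W: "W = (\<Union>k\<in>K. X k)"
    and tail: "\<And>u x. u \<frown> x \<in> W \<longleftrightarrow> x \<in> W"
  shows "\<exists>\<phi> :: 'a list \<Rightarrow> (nat \<times> bool \<times> nat) set list. tail_recognition \<phi> W"
proof -
  have "\<forall>k. \<exists>Q I \<delta> F. k < n \<longrightarrow> finite Q \<and> \<delta> \<subseteq> Q \<times> UNIV \<times> Q \<and> X k = {w. buchi_accepts Q I \<delta> F w}"
    using reg unfolding omega_regular_def by meson
  then obtain Q I \<delta> F where A: "\<And>k. k < n \<Longrightarrow> finite (Q k)" "\<And>k. k < n \<Longrightarrow> \<delta> k \<subseteq> Q k \<times> UNIV \<times> Q k"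
    "\<And>k. k < n \<Longrightarrow> X k = {w. buchi_accepts (Q k) (I k) (\<delta> k) (F k) w}"
    by metis
  define \<phi> where "\<phi> u = map (\<lambda>k. profile (\<delta> k) (F k) u) [0..<n]" for u
  have eq: "\<phi> u = \<phi> v \<longleftrightarrow> (\<forall>k<n. profile (\<delta> k) (F k) u = profile (\<delta> k) (F k) v)" for u v
    by (auto simp: \<phi>_def)
  have "tail_recognition \<phi> W"
  proof
    let ?P = "\<Union>k<n. range (profile (\<delta> k) (F k))"
    have "finite ?P"
      by (intro finite_UN_I finite_lessThan finite_range_profile) (use A(1,2) in simp_all)
    then have "finite {xs. set xs \<subseteq> ?P \<and> length xs = n}" by (rule finite_lists_length_eq)
    moreover have "range \<phi> \<subseteq> {xs. set xs \<subseteq> ?P \<and> length xs = n}"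
      by (auto simp: \<phi>_def intro!: bexI rangeI)
    ultimately show "finite (range \<phi>)" by (rule rev_finite_subset)
  next
    fix u u' v v' assume "\<phi> u = \<phi> u'" "\<phi> v = \<phi> v'"
    then show "\<phi> (u @ v) = \<phi> (u' @ v')" unfolding eq by (meson profile_cong)
  next
    fix u x show "u \<frown> x \<in> W \<longleftrightarrow> x \<in> W" by (rule tail)
  next
    fix c c' w w'
    assume c: "strict_mono c" "strict_mono c'"
      and bl: "\<And>n. \<phi> (w [c n \<rightarrow> c (Suc n)]) = \<phi> (w' [c' n \<rightarrow> c' (Suc n)])" and w: "w \<in> W"
    \<comment> \<open>By tail invariance both words can be cut where their first block begins, as
      \<open>buchi_accepts_blocks\<close> requires.\<close>
    have suf: "suffix k x \<in> W \<longleftrightarrow> x \<in> W" for k x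
      using tail[of "prefix k x" "suffix k x"] by simp
    have mono: "strict_mono (\<lambda>n. c n - c 0)" if "strict_mono c" for c :: "nat \<Rightarrow> nat"
      using that unfolding strict_mono_Suc_iff
      by (metis diff_less_mono le0 strict_mono_less_eq that)
    have shift: "(suffix (c 0) x) [c m - c 0 \<rightarrow> c (Suc m) - c 0] = x [c m \<rightarrow> c (Suc m)]"
      if "strict_mono c" for c :: "nat \<Rightarrow> nat" and x :: "'a word" and m
      using that by (simp add: strict_mono_less_eq)
    have "suffix (c 0) w \<in> W" using w suf by simp
    then obtain k where k: "k \<in> K" "suffix (c 0) w \<in> X k" using W by blast
    then have "k < n" using K by blast
    have "buchi_accepts (Q k) (I k) (\<delta> k) (F k) (suffix (c' 0) w')"
    proof (rule buchi_accepts_blocks[OF mono[OF c(1)] _ mono[OF c(2)]])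
      fix m
      show "profile (\<delta> k) (F k) (suffix (c 0) w [c m - c 0 \<rightarrow> c (Suc m) - c 0]) =
          profile (\<delta> k) (F k) (suffix (c' 0) w' [c' m - c' 0 \<rightarrow> c' (Suc m) - c' 0])"
        unfolding shift[OF c(1)] shift[OF c(2)] using bl[of m] \<open>k < n\<close> unfolding eq by blast
    qed (use k A(3) \<open>k < n\<close> in auto)
    then have "suffix (c' 0) w' \<in> W" using A(3)[OF \<open>k < n\<close>] k(1) W by blast
    then show "w' \<in> W" using suf by simp
  qed
  then show ?thesis by blast
qed

subsection \<open>Preferences, values and punishment\<close>

locale total_preference =
  fixes R :: "('a word \<times> 'a word) set"
  assumes recognizable: "omega_recognizable R" and refl: "refl R" and trans: "trans R"
    and total: "total R" and prefix_indep: "prefix_independent R"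
begin

lemma R_refl: "(x, x) \<in> R" using refl by (simp add: refl_on_def)

lemma R_trans: "(x, y) \<in> R \<Longrightarrow> (y, z) \<in> R \<Longrightarrow> (x, z) \<in> R" using trans by (rule transD)

lemma R_total: "(x, y) \<in> R \<or> (y, x) \<in> R"
  using total R_refl[of x] by (cases "x = y") (simp_all add: total_on_def)

text \<open>Applied to the pair \<open>(x, x)\<close>, prefix-independence puts \<open>x\<close> and
  all its prolongations to the left into one class.\<close>

lemma R_tail: "(u \<frown> x, y) \<in> R \<longleftrightarrow> (x, y) \<in> R"
proof -
  have "\<forall>u v. (u \<frown> x, v \<frown> x) \<in> R"
    using prefix_indep R_refl unfolding prefix_independent_def by blast
  then have "(u \<frown> x, [] \<frown> x) \<in> R" "([] \<frown> x, u \<frown> x) \<in> R" by blast+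
  then show ?thesis using R_trans[of "u \<frown> x" x y] R_trans[of x "u \<frown> x" y] by auto
qed

lemma R_suffix: "(suffix k x, y) \<in> R \<longleftrightarrow> (x, y) \<in> R"
  using R_tail[of "prefix k x" "suffix k x" y] by simp

lemma cls_eq_iff: "cls R x = cls R y \<longleftrightarrow> (x, y) \<in> R \<and> (y, x) \<in> R"
proof
  assume "cls R x = cls R y"
  then have "y \<in> cls R x" using R_refl by (simp add: cls_def)
  then show "(x, y) \<in> R \<and> (y, x) \<in> R" by (simp add: cls_def)
next
  assume "(x, y) \<in> R \<and> (y, x) \<in> R"
  then show "cls R x = cls R y" unfolding cls_def using R_trans by blast
qed

lemma cls_le_cls: "cls_le R (cls R x) (cls R y) \<longleftrightarrow> (x, y) \<in> R"
  unfolding cls_le_def cls_eq_iff using R_trans R_refl by blast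

text \<open>With \<open>\<rho>\<close> fixed, the words below it form the union of those
  \<open>X k\<close> for which \<open>Y k\<close> contains \<open>\<rho>\<close>.\<close>

lemma ex_first_inf_below: "\<exists>Hcs. \<forall>\<pi>. (\<pi>, \<rho>) \<in> R \<longleftrightarrow> first_inf d Hcs \<pi>"
proof -
  obtain n :: nat and X Y where XY: "\<forall>k<n. omega_regular (X k) \<and> omega_regular (Y k)"
    "R = (\<Union>k<n. X k \<times> Y k)"
    using recognizable unfolding omega_recognizable_def by blast
  define W where "W = {\<pi>. (\<pi>, \<rho>) \<in> R}"
  have "W = (\<Union>k\<in>{k. k < n \<and> \<rho> \<in> Y k}. X k)" using XY(2) by (auto simp: W_def)
  moreover have "u \<frown> x \<in> W \<longleftrightarrow> x \<in> W" for u x using R_tail by (simp add: W_def)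
  ultimately obtain \<phi> :: "'a list \<Rightarrow> (nat \<times> bool \<times> nat) set list" where "tail_recognition \<phi> W"
    using omega_regular_union_recognition[of n X "{k. k < n \<and> \<rho> \<in> Y k}" W] XY(1) by auto
  then show ?thesis using tail_recognition.ex_first_inf[of \<phi> W d] by (simp add: W_def)
qed

text \<open>\<open>f\<close> recovers the class of \<open>x\<close> from the indices of the
  \<open>X k\<close> and of the \<open>Y k\<close> that contain \<open>x\<close>.\<close>

lemma finite_classes: "finite (range (cls R))"
proof -
  obtain n :: nat and X Y where R: "R = (\<Union>k<n. X k \<times> Y k)"
    using recognizable unfolding omega_recognizable_def by blast
  define f where "f = (\<lambda>(A, B). {y. (\<exists>k\<in>A. y \<in> Y k) \<and> (\<exists>k\<in>B. y \<in> X k)})"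
  have "cls R x = f ({k. k < n \<and> x \<in> X k}, {k. k < n \<and> x \<in> Y k})" for x
    unfolding cls_def f_def R by auto
  then have "range (cls R) \<subseteq> f ` (Pow {..<n} \<times> Pow {..<n})" by blast
  then show ?thesis by (rule finite_subset) simp
qed

end

lemma finite_total_preorder_least:
  assumes "finite B" "B \<noteq> {}" and total: "\<And>x y. P x y \<or> P y x"
    and trans: "\<And>x y z. P x y \<Longrightarrow> P y z \<Longrightarrow> P x z"
  shows "\<exists>x\<in>B. \<forall>y\<in>B. P x y"
  using assms(1,2)
proof (induction B rule: finite_ne_induct)
  case (singleton x)
  then show ?case using total by blast
next
  case (insert x B)
  then obtain m where m: "m \<in> B" "\<forall>y\<in>B. P m y" by blast
  show ?case
  proof (cases "P x m")
    case True
    then show ?thesis using m trans total by (metis insert_iff)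
  next
    case False
    then show ?thesis using m total by (metis insert_iff)
  qed
qed

context total_preference
begin

text \<open>Finitely many representatives \<open>B\<close> of the classes met by \<open>A\<close>
  suffice; \<open>P\<close> covers both directions of the order.\<close>

lemma ex_extremal:
  assumes "A \<noteq> {}" and P: "P = (\<lambda>x y. (x, y) \<in> R) \<or> P = (\<lambda>x y. (y, x) \<in> R)"
  shows "\<exists>x\<in>A. \<forall>y\<in>A. P x y"
proof -
  have "finite (cls R ` A)" by (rule finite_subset[OF _ finite_classes]) blast
  then obtain B where B: "B \<subseteq> A" "finite B" "cls R ` A = cls R ` B"
    using finite_subset_image[of "cls R ` A" "cls R" A] by blast
  have total: "P x y \<or> P y x" for x y using P R_total[of x y] by auto
  have trans: "P x y \<Longrightarrow> P y z \<Longrightarrow> P x z" for x y z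
    using P R_trans[of x y z] R_trans[of z y x] by auto
  have "B \<noteq> {}" using B assms(1) by auto
  then obtain x where x: "x \<in> B" "\<forall>y\<in>B. P x y"
    using finite_total_preorder_least[of B P] B(2) total trans by blast
  have "P x y" if "y \<in> A" for y
  proof -
    obtain z where z: "z \<in> B" "cls R y = cls R z" using B(3) \<open>y \<in> A\<close> by (metis imageE imageI)
    then have "P z y" using P cls_eq_iff by auto
    then show ?thesis using x(2) z(1) trans by blast
  qed
  then show ?thesis using x(1) B(1) by blast
qed

lemma ex_least: "A \<noteq> {} \<Longrightarrow> \<exists>x\<in>A. \<forall>y\<in>A. (x, y) \<in> R"
  by (rule ex_extremal) simp_all

lemma ex_greatest: "A \<noteq> {} \<Longrightarrow> \<exists>x\<in>A. \<forall>y\<in>A. (y, x) \<in> R"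
  by (rule ex_extremal[where P = "\<lambda>x y. (y, x) \<in> R"]) simp_all

end

section \<open>Outcomes of strategy profiles\<close>

lemma out_hist_outcome: "out_hist own \<sigma> v n = prefix (Suc n) (outcome own \<sigma> v)"
proof (induction n)
  case (Suc n)
  have "outcome own \<sigma> v (Suc n) = last (out_hist own \<sigma> v (Suc n))" by (simp add: outcome_def)
  then have "out_hist own \<sigma> v (Suc n) = out_hist own \<sigma> v n @ [outcome own \<sigma> v (Suc n)]"
    by (simp add: Let_def)
  then show ?case using Suc by simp
qed (simp add: outcome_def)

lemma outcome_0: "outcome own \<sigma> v 0 = v"
  by (simp add: outcome_def)

lemma outcome_Suc:
  "outcome own \<sigma> v (Suc n) =
    \<sigma> (own (outcome own \<sigma> v n)) (prefix (Suc n) (outcome own \<sigma> v))"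
proof -
  have "outcome own \<sigma> v (Suc n) = \<sigma> (own (last (out_hist own \<sigma> v n))) (out_hist own \<sigma> v n)"
    by (simp add: outcome_def Let_def)
  then show ?thesis unfolding out_hist_outcome by simp
qed

lemma outcome_prefix_eqI:
  assumes "\<pi> 0 = v" "\<And>k. k < n \<Longrightarrow> \<pi> (Suc k) = \<sigma> (own (\<pi> k)) (prefix (Suc k) \<pi>)"
  shows "prefix (Suc n) (outcome own \<sigma> v) = prefix (Suc n) \<pi>"
  using assms(2)
proof (induction n)
  case 0
  then show ?case using assms(1) by (simp add: outcome_0)
next
  case (Suc n)
  then have IH: "prefix (Suc n) (outcome own \<sigma> v) = prefix (Suc n) \<pi>" by simp
  then have "outcome own \<sigma> v n = \<pi> n" using prefix_eqD[OF IH, of n] by simp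
  then have "outcome own \<sigma> v (Suc n) = \<pi> (Suc n)"
    using Suc.prems[of n] IH outcome_Suc[of own \<sigma> v n] by simp
  then show ?case using IH by (metis le0 subseq_to_Suc)
qed

lemma is_history_prefix:
  "(\<And>k. k < n \<Longrightarrow> (\<pi> k, \<pi> (Suc k)) \<in> E) \<Longrightarrow> is_history E (prefix (Suc n) \<pi>)"
  unfolding is_history_def by (auto simp del: subseq_to_Suc)

lemma is_play_outcome:
  assumes "\<And>v. \<sigma> (own v) \<in> strategies E own (own v)"
  shows "is_play E (outcome own \<sigma> v)"
proof -
  let ?\<pi> = "outcome own \<sigma> v"
  have "(?\<pi> n, ?\<pi> (Suc n)) \<in> E" for n
  proof (induction n rule: less_induct)
    case (less n)
    then have "is_history E (prefix (Suc n) ?\<pi>)" by (rule is_history_prefix)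
    moreover have "last (prefix (Suc n) ?\<pi>) = ?\<pi> n" by simp
    ultimately have "(?\<pi> n, \<sigma> (own (?\<pi> n)) (prefix (Suc n) ?\<pi>)) \<in> E"
      using assms[of "?\<pi> n"] unfolding strategies_def by fastforce
    then show ?case by (simp only: outcome_Suc)
  qed
  then show ?thesis by (simp add: is_play_def)
qed

lemma strategies_nonempty:
  assumes "\<forall>v. \<exists>w. (v, w) \<in> E"
  shows "\<exists>\<sigma>. \<sigma> \<in> strategies E own i"
proof -
  obtain f where "\<forall>v. (v, f v) \<in> E" using assms by metis
  then show ?thesis by (intro exI[of _ "\<lambda>h. f (last h)"]) (simp add: strategies_def)
qed

lemma ex_consistent:
  assumes "\<forall>v. \<exists>w. (v, w) \<in> E" "\<sigma> \<in> strategies E own i"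
  shows "\<exists>\<pi>. consistent E own i \<sigma> \<pi> \<and> \<pi> 0 = v"
proof -
  have "\<forall>j. \<exists>\<tau>. \<tau> \<in> strategies E own j"
    by (intro allI strategies_nonempty assms(1))
  from choice[OF this] obtain \<tau> where \<tau>: "\<And>j. \<tau> j \<in> strategies E own j" by blast
  let ?\<pi> = "outcome own (\<tau>(i := \<sigma>)) v"
  have "is_play E ?\<pi>" by (rule is_play_outcome) (simp add: \<tau> assms(2))
  moreover have "?\<pi> (Suc n) = \<sigma> (prefix (Suc n) ?\<pi>)" if "own (?\<pi> n) = i" for n
    using that outcome_Suc[of own "\<tau>(i := \<sigma>)" v n] by simp
  ultimately show ?thesis unfolding consistent_def using outcome_0 by metis
qed

context total_preference
begin

text \<open>Finiteness of the set of classes gives a least one and antisymmetry on classes its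
  uniqueness, so the description in \<open>min_cls\<close> is proper.\<close>

lemma min_cls_eq:
  fixes v :: 'a
  assumes "\<forall>v. \<exists>w. (v, w) \<in> E" "\<sigma> \<in> strategies E own i"
  obtains \<pi> where "consistent E own i \<sigma> \<pi>" "\<pi> 0 = v" "min_cls E own R i \<sigma> v = cls R \<pi>"
    "\<And>\<pi>'. consistent E own i \<sigma> \<pi>' \<Longrightarrow> \<pi>' 0 = v \<Longrightarrow> (\<pi>, \<pi>') \<in> R"
proof -
  have "{\<pi>. consistent E own i \<sigma> \<pi> \<and> \<pi> 0 = v} \<noteq> {}" using ex_consistent[OF assms, of v] by simp
  from ex_least[OF this] obtain \<pi> where \<pi>: "consistent E own i \<sigma> \<pi>" "\<pi> 0 = v"
    "\<And>\<pi>'. consistent E own i \<sigma> \<pi>' \<Longrightarrow> \<pi>' 0 = v \<Longrightarrow> (\<pi>, \<pi>') \<in> R"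
    by blast
  have "min_cls E own R i \<sigma> v = cls R \<pi>"
    unfolding min_cls_def
  proof (rule the_equality)
    show "cls R \<pi> \<in> {cls R \<pi> |\<pi>. consistent E own i \<sigma> \<pi> \<and> \<pi> 0 = v} \<and>
        (\<forall>D\<in>{cls R \<pi> |\<pi>. consistent E own i \<sigma> \<pi> \<and> \<pi> 0 = v}. cls_le R (cls R \<pi>) D)"
      using \<pi> by (auto simp: cls_le_cls)
  next
    fix C assume C: "C \<in> {cls R \<pi> |\<pi>. consistent E own i \<sigma> \<pi> \<and> \<pi> 0 = v} \<and>
        (\<forall>D\<in>{cls R \<pi> |\<pi>. consistent E own i \<sigma> \<pi> \<and> \<pi> 0 = v}. cls_le R C D)"
    then obtain \<pi>' where \<pi>': "C = cls R \<pi>'" "consistent E own i \<sigma> \<pi>'" "\<pi>' 0 = v" by blast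
    moreover have "cls_le R C (cls R \<pi>)" using C \<pi>(1,2) by blast
    ultimately show "C = cls R \<pi>" using \<pi>(3) by (simp add: cls_le_cls cls_eq_iff)
  qed
  with \<pi> show thesis using that by blast
qed

text \<open>The value enters the later proofs only in this form: \<open>i\<close> has no strategy
  that guarantees more than \<open>\<rho>\<close>.\<close>

lemma val_le_iff:
  fixes v :: 'a
  assumes succ: "\<forall>v. \<exists>w. (v, w) \<in> E"
  shows "cls_le R (val E own R i v) (cls R \<rho>) \<longleftrightarrow>
    (\<forall>\<sigma>\<in>strategies E own i. \<exists>\<pi>. consistent E own i \<sigma> \<pi> \<and> \<pi> 0 = v \<and> (\<pi>, \<rho>) \<in> R)"
proof -
  let ?S = "strategies E own i"
  have "\<forall>\<sigma>. \<exists>\<pi>. \<sigma> \<in> ?S \<longrightarrow> consistent E own i \<sigma> \<pi> \<and> \<pi> 0 = v \<and> min_cls E own R i \<sigma> v = cls R \<pi> \<and>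
      (\<forall>\<pi>'. consistent E own i \<sigma> \<pi>' \<and> \<pi>' 0 = v \<longrightarrow> (\<pi>, \<pi>') \<in> R)"
    using min_cls_eq[OF succ] by metis
  then obtain m where m: "\<And>\<sigma>. \<sigma> \<in> ?S \<Longrightarrow> consistent E own i \<sigma> (m \<sigma>)" "\<And>\<sigma>. \<sigma> \<in> ?S \<Longrightarrow> m \<sigma> 0 = v"
    "\<And>\<sigma>. \<sigma> \<in> ?S \<Longrightarrow> min_cls E own R i \<sigma> v = cls R (m \<sigma>)"
    "\<And>\<sigma> \<pi>. \<sigma> \<in> ?S \<Longrightarrow> consistent E own i \<sigma> \<pi> \<Longrightarrow> \<pi> 0 = v \<Longrightarrow> (m \<sigma>, \<pi>) \<in> R"
    by metis
  have "m ` ?S \<noteq> {}" using strategies_nonempty[OF succ, of own i] by blast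
  from ex_greatest[OF this] obtain \<sigma>0 where \<sigma>0: "\<sigma>0 \<in> ?S" "\<And>\<sigma>. \<sigma> \<in> ?S \<Longrightarrow> (m \<sigma>, m \<sigma>0) \<in> R"
    by blast
  have "val E own R i v = cls R (m \<sigma>0)"
    unfolding val_def
  proof (rule the_equality)
    show "cls R (m \<sigma>0) \<in> {min_cls E own R i \<sigma> v |\<sigma>. \<sigma> \<in> ?S} \<and>
        (\<forall>D\<in>{min_cls E own R i \<sigma> v |\<sigma>. \<sigma> \<in> ?S}. cls_le R D (cls R (m \<sigma>0)))"
      using \<sigma>0 m(3) by (auto simp: cls_le_cls)
  next
    fix C assume C: "C \<in> {min_cls E own R i \<sigma> v |\<sigma>. \<sigma> \<in> ?S} \<and>
        (\<forall>D\<in>{min_cls E own R i \<sigma> v |\<sigma>. \<sigma> \<in> ?S}. cls_le R D C)"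
    then obtain \<sigma> where \<sigma>: "C = cls R (m \<sigma>)" "\<sigma> \<in> ?S" using m(3) by blast
    moreover have "cls_le R (cls R (m \<sigma>0)) C" using C \<sigma>0(1) m(3) by blast
    ultimately show "C = cls R (m \<sigma>0)" using \<sigma>0(2) by (simp add: cls_le_cls cls_eq_iff)
  qed
  then have "cls_le R (val E own R i v) (cls R \<rho>) \<longleftrightarrow> (m \<sigma>0, \<rho>) \<in> R" by (simp add: cls_le_cls)
  also have "\<dots> \<longleftrightarrow> (\<forall>\<sigma>\<in>?S. (m \<sigma>, \<rho>) \<in> R)" using \<sigma>0 R_trans by blast
  also have "\<dots> \<longleftrightarrow> (\<forall>\<sigma>\<in>?S. \<exists>\<pi>. consistent E own i \<sigma> \<pi> \<and> \<pi> 0 = v \<and> (\<pi>, \<rho>) \<in> R)"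
    using m R_trans by blast
  finally show ?thesis .
qed

text \<open>In the game of the coalition (\<open>turn\<close> is \<open>True\<close>) against
  \<open>i\<close>, a coalition that did not win would, by determinacy, leave \<open>i\<close> a
  strategy all of whose plays are strictly above \<open>\<rho>\<close>, against
  \<open>val_le_iff\<close>.\<close>

lemma punishing_strategy:
  fixes v :: 'a
  assumes succ: "\<forall>v. \<exists>w. (v, w) \<in> E" and val: "cls_le R (val E own R i v) (cls R \<rho>)"
  shows "\<exists>s. (\<forall>h. (last h, s h) \<in> E) \<and>
    (\<forall>\<pi>. is_play E \<pi> \<and> \<pi> 0 = v \<and> (\<forall>m. own (\<pi> m) \<noteq> i \<longrightarrow> \<pi> (Suc m) = s (prefix (Suc m) \<pi>))
      \<longrightarrow> (\<pi>, \<rho>) \<in> R)"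
proof -
  define M where "M h = {w. (last h, w) \<in> E}" for h
  define turn where "turn h \<longleftrightarrow> own (last h) \<noteq> i" for h
  interpret tree_game M turn using succ by unfold_locales (auto simp: M_def)
  obtain Hcs where Hcs: "\<And>\<pi>. (\<pi>, \<rho>) \<in> R \<longleftrightarrow> first_inf True Hcs \<pi>"
    using ex_first_inf_below by blast
  obtain b where "wins b (\<lambda>\<pi>. first_inf True Hcs \<pi> = b) [v]"
    using first_inf_determined by blast
  then obtain s where s: "\<forall>h. (last h, s h) \<in> E" "\<And>\<pi>. follows b s [v] \<pi> \<Longrightarrow> ((\<pi>, \<rho>) \<in> R) = b"
    unfolding wins_def legal_def by (auto simp: M_def Hcs)
  \<comment> \<open>\<open>follows\<close> indexes a move by the length of the history before it,
    \<open>consistent\<close> by the last vertex of that history; the indices differ by one.\<close>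
  have followsI: "follows b s [v] \<pi>"
    if "is_play E \<pi>" "\<pi> 0 = v" "\<forall>m. (own (\<pi> m) \<noteq> i) = b \<longrightarrow> \<pi> (Suc m) = s (prefix (Suc m) \<pi>)" for \<pi>
    unfolding follows_def
  proof (intro conjI allI impI)
    show "prefix (length [v]) \<pi> = [v]" using that(2) by simp
  next
    fix m assume "length [v] \<le> m"
    then obtain k where "m = Suc k" by (cases m) auto
    then show "\<pi> m \<in> M (prefix m \<pi>)" using that(1) by (simp add: M_def is_play_def)
  next
    fix m assume "length [v] \<le> m" "turn (prefix m \<pi>) = b"
    moreover then obtain k where k: "m = Suc k" by (cases m) auto
    ultimately have "(own (\<pi> k) \<noteq> i) = b" by (simp add: turn_def)
    then show "\<pi> m = s (prefix m \<pi>)" using that(3) k by blast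
  qed
  have b
  proof (rule ccontr)
    assume "\<not> b"
    have "s \<in> strategies E own i" using s(1) by (simp add: strategies_def)
    then obtain \<pi> where \<pi>: "consistent E own i s \<pi>" "\<pi> 0 = v" "(\<pi>, \<rho>) \<in> R"
      using val unfolding val_le_iff[OF succ] by blast
    then have "follows b s [v] \<pi>" using followsI[of \<pi>] \<open>\<not> b\<close> by (simp add: consistent_def del: subseq_to_Suc)
    then show False using s(2) \<pi>(3) \<open>\<not> b\<close> by blast
  qed
  then show ?thesis using s followsI by (intro exI[of _ s]) (simp del: subseq_to_Suc)
qed

end

section \<open>The characterization of equilibrium outcomes\<close>

theorem theorem13:
  fixes E :: "('v::finite \<times> 'v) set"
    and P :: "'p set"
    and own :: "'v \<Rightarrow> 'p"
    and pref :: "'p \<Rightarrow> ('v word \<times> 'v word) set"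
    and \<rho> :: "'v word"
  assumes fin_P: "finite P"
    and own_P: "\<forall>v. own v \<in> P"
    and succ: "\<forall>v. \<exists>w. (v, w) \<in> E"
    and recog: "\<forall>i\<in>P. omega_recognizable (pref i)"
    and preord: "\<forall>i\<in>P. refl (pref i) \<and> trans (pref i)"
    and tot: "\<forall>i\<in>P. total (pref i)"
    and pind: "\<forall>i\<in>P. prefix_independent (pref i)"
    and play: "is_play E \<rho>"
  shows "(\<exists>\<sigma>. nash_eq E P own pref \<sigma> (\<rho> 0) \<and> outcome own \<sigma> (\<rho> 0) = \<rho>) \<longleftrightarrow>
         (\<forall>n. \<forall>i\<in>P. own (\<rho> n) = i \<longrightarrow>
            cls_le (pref i) (val E own (pref i) i (\<rho> n)) (cls (pref i) \<rho>))"
proof -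
  have tp: "total_preference (pref i)" if "i \<in> P" for i
    using that recog preord tot pind by (simp add: total_preference_def)
  show ?thesis
  proof
    assume "\<exists>\<sigma>. nash_eq E P own pref \<sigma> (\<rho> 0) \<and> outcome own \<sigma> (\<rho> 0) = \<rho>"
    then obtain \<sigma> where nash: "nash_eq E P own pref \<sigma> (\<rho> 0)" and out: "outcome own \<sigma> (\<rho> 0) = \<rho>"
      by blast
    have \<sigma>: "\<sigma> i \<in> strategies E own i" if "i \<in> P" for i
      using nash that unfolding nash_eq_def by blast
    have stable: "\<not> strict_pref (pref i) \<rho> (outcome own (\<sigma>(i := \<tau>)) (\<rho> 0))"
      if "i \<in> P" "\<tau> \<in> strategies E own i" for i \<tau>
      using nash that unfolding nash_eq_def out by blast
    have \<rho>: "\<rho> (Suc n) = \<sigma> (own (\<rho> n)) (prefix (Suc n) \<rho>)" for n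
      using outcome_Suc[of own \<sigma> "\<rho> 0" n] out by simp
    show "\<forall>n. \<forall>i\<in>P. own (\<rho> n) = i \<longrightarrow>
        cls_le (pref i) (val E own (pref i) i (\<rho> n)) (cls (pref i) \<rho>)"
    proof (intro allI ballI impI)
      fix n i assume i: "i \<in> P" "own (\<rho> n) = i"
      interpret total_preference "pref i" by (rule tp[OF i(1)])
      show "cls_le (pref i) (val E own (pref i) i (\<rho> n)) (cls (pref i) \<rho>)"
        unfolding val_le_iff[OF succ]
      proof
        fix \<tau> assume \<tau>: "\<tau> \<in> strategies E own i"
        \<comment> \<open>The deviation obeys \<open>\<sigma> i\<close> until
          \<open>\<rho> n\<close> is reached and then plays \<open>\<tau>\<close> as if the game
          began there: \<open>drop n h\<close> keeps the vertex with index \<open>n\<close> as its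
          first entry.\<close>
        define \<tau>' where "\<tau>' h = (if length h \<le> n then \<sigma> i h else \<tau> (drop n h))" for h
        have \<tau>': "\<tau>' \<in> strategies E own i"
          unfolding strategies_def
        proof (intro CollectI allI impI)
          fix h assume h: "is_history E h \<and> own (last h) = i"
          show "(last h, \<tau>' h) \<in> E"
          proof (cases "length h \<le> n")
            case True
            then show ?thesis using \<sigma>[OF i(1)] h by (simp add: \<tau>'_def strategies_def)
          next
            case False
            then have "is_history E (drop n h)" "last (drop n h) = last h"
              using h by (auto simp: is_history_def)
            then show ?thesis using False \<tau> h by (auto simp: \<tau>'_def strategies_def)
          qed
        qed
        define \<pi> where "\<pi> = outcome own (\<sigma>(i := \<tau>')) (\<rho> 0)"
        have \<pi>_Suc: "\<pi> (Suc k) = (\<sigma>(i := \<tau>')) (own (\<pi> k)) (prefix (Suc k) \<pi>)" for k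
          unfolding \<pi>_def by (rule outcome_Suc)
        have "\<rho> (Suc k) = (\<sigma>(i := \<tau>')) (own (\<rho> k)) (prefix (Suc k) \<rho>)" if "k < n" for k
          using \<rho>[of k] that by (simp add: \<tau>'_def del: subseq_to_Suc)
        then have eq: "prefix (Suc n) \<pi> = prefix (Suc n) \<rho>"
          unfolding \<pi>_def by (rule outcome_prefix_eqI[OF HOL.refl])
        have "is_play E \<pi>"
          unfolding \<pi>_def by (rule is_play_outcome) (use \<tau>' \<sigma> own_P in simp)
        then have "consistent E own i \<tau> (suffix n \<pi>)"
          using \<pi>_Suc by (simp add: consistent_def is_play_def \<tau>'_def del: subseq_to_Suc)
        moreover have "suffix n \<pi> 0 = \<rho> n" using prefix_eqD[OF eq, of n] by simp
        moreover have "(\<pi>, \<rho>) \<in> pref i"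
          using stable[OF i(1) \<tau>'] R_total[of \<pi> \<rho>] unfolding strict_pref_def \<pi>_def by blast
        ultimately show "\<exists>\<pi>. consistent E own i \<tau> \<pi> \<and> \<pi> 0 = \<rho> n \<and> (\<pi>, \<rho>) \<in> pref i"
          using R_suffix by blast
      qed
    qed
  next
    assume val: "\<forall>n. \<forall>i\<in>P. own (\<rho> n) = i \<longrightarrow>
        cls_le (pref i) (val E own (pref i) i (\<rho> n)) (cls (pref i) \<rho>)"
    have "\<exists>s. (\<forall>h. (last h, s h) \<in> E) \<and>
      (\<forall>\<pi>. is_play E \<pi> \<and> \<pi> 0 = \<rho> n \<and> (\<forall>m. own (\<pi> m) \<noteq> own (\<rho> n) \<longrightarrow> \<pi> (Suc m) = s (prefix (Suc m) \<pi>))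
        \<longrightarrow> (\<pi>, \<rho>) \<in> pref (own (\<rho> n)))" for n
      by (rule total_preference.punishing_strategy[OF tp succ]) (use val own_P in blast)+
    then obtain s where s: "\<And>n h. (last h, s n h) \<in> E"
      and punish: "\<And>n \<pi>. is_play E \<pi> \<Longrightarrow> \<pi> 0 = \<rho> n \<Longrightarrow>
        (\<And>m. own (\<pi> m) \<noteq> own (\<rho> n) \<Longrightarrow> \<pi> (Suc m) = s n (prefix (Suc m) \<pi>)) \<Longrightarrow>
        (\<pi>, \<rho>) \<in> pref (own (\<rho> n))"
      by metis
    \<comment> \<open>The \<open>LEAST\<close> is where \<open>h\<close> first differs from
      \<open>\<rho>\<close>; one less is the vertex whose owner made the deviating move. Truncated
      subtraction gives 0 for a wrong initial vertex.\<close>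
    define d where "d h = (LEAST k. h ! k \<noteq> \<rho> k) - 1" for h
    \<comment> \<open>All players share one rule: continue \<open>\<rho>\<close>, and after a
      deviation play the strategy punishing the owner of the vertex it left, restarted at that
      vertex. The deviator's own component is the one replaced by \<open>\<tau>\<close>.\<close>
    define \<sigma> where
      "\<sigma> j h = (if h = prefix (length h) \<rho> then \<rho> (length h) else s (d h) (drop (d h) h))" for j :: 'p and h
    have d_less: "d h < length h" if "h \<noteq> prefix (length h) \<rho>" for h
    proof -
      obtain k where k: "k < length h" "h ! k \<noteq> \<rho> k"
        using \<open>h \<noteq> prefix (length h) \<rho>\<close> by (metis add_0 diff_zero nth_equalityI subsequence_length subsequence_nth)
      then have "(LEAST k. h ! k \<noteq> \<rho> k) \<le> k" by (intro Least_le)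
      then show ?thesis using k(1) by (simp add: d_def)
    qed
    have \<sigma>: "\<sigma> j \<in> strategies E own j" for j
      unfolding strategies_def
    proof (intro CollectI allI impI)
      fix h assume "is_history E h \<and> own (last h) = j"
      then have "h \<noteq> []" by (simp add: is_history_def)
      show "(last h, \<sigma> j h) \<in> E"
      proof (cases "h = prefix (length h) \<rho>")
        case True
        obtain l where l: "length h = Suc l" using \<open>h \<noteq> []\<close> by (cases h) auto
        then have "last h = \<rho> l" using True by (metis diff_Suc_1 diff_zero last_conv_nth lessI \<open>h \<noteq> []\<close> add_0 subsequence_nth)
        then show ?thesis using True l play by (simp add: \<sigma>_def is_play_def del: subseq_to_Suc)
      next
        case False
        then show ?thesis using s[of "drop (d h) h" "d h"] d_less[OF False] by (simp add: \<sigma>_def)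
      qed
    qed
    have "prefix (Suc n) (outcome own \<sigma> (\<rho> 0)) = prefix (Suc n) \<rho>" for n
      by (rule outcome_prefix_eqI) (simp_all add: \<sigma>_def del: subseq_to_Suc)
    then have out: "outcome own \<sigma> (\<rho> 0) = \<rho>"
      using prefix_eqD by (metis ext lessI)
    have "\<not> strict_pref (pref i) \<rho> (outcome own (\<sigma>(i := \<tau>)) (\<rho> 0))"
      if i: "i \<in> P" and \<tau>: "\<tau> \<in> strategies E own i" for i \<tau>
    proof -
      interpret total_preference "pref i" by (rule tp[OF i])
      define \<pi> where "\<pi> = outcome own (\<sigma>(i := \<tau>)) (\<rho> 0)"
      have \<pi>_Suc: "\<pi> (Suc k) = (\<sigma>(i := \<tau>)) (own (\<pi> k)) (prefix (Suc k) \<pi>)" for k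
        unfolding \<pi>_def by (rule outcome_Suc)
      have "(\<pi>, \<rho>) \<in> pref i"
      proof (cases "\<pi> = \<rho>")
        case True
        then show ?thesis using R_refl by simp
      next
        case False
        define k where "k = (LEAST k. \<pi> k \<noteq> \<rho> k)"
        have "\<exists>k. \<pi> k \<noteq> \<rho> k" using False by blast
        then have k: "\<pi> k \<noteq> \<rho> k" unfolding k_def by (rule LeastI_ex)
        have before: "\<pi> j = \<rho> j" if "j < k" for j using that not_less_Least unfolding k_def by blast
        have "\<pi> 0 = \<rho> 0" by (simp add: \<pi>_def outcome_0)
        then obtain n where n: "k = Suc n" using k by (cases k) auto
        have pre: "prefix k \<pi> = prefix k \<rho>" by (rule nth_equalityI) (simp_all add: before)
        \<comment> \<open>Everyone but \<open>i\<close> obeys \<open>\<sigma>\<close>, which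
          continues \<open>\<rho>\<close>; so the move leaving \<open>\<rho>\<close> was made by
          \<open>i\<close>.\<close>
        have own_n: "own (\<rho> n) = i"
        proof (rule ccontr)
          assume "own (\<rho> n) \<noteq> i"
          then have "\<pi> k = \<sigma> (own (\<rho> n)) (prefix k \<rho>)"
            using \<pi>_Suc[of n] before[of n] pre n by simp
          then show False using k by (simp add: \<sigma>_def)
        qed
        have follow: "suffix n \<pi> (Suc m) = s n (prefix (Suc m) (suffix n \<pi>))"
          if "own (suffix n \<pi> m) \<noteq> own (\<rho> n)" for m
        proof -
          \<comment> \<open>At index 0 the deviator \<open>i\<close> moves. The coalition is first
            asked to move once the deviation is visible in the history, so that \<open>d\<close> can
            locate it.\<close>
          have "m \<noteq> 0"
          proof
            assume "m = 0"
            then show False using that before[of n] n by simp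
          qed
          let ?h = "prefix (Suc (n + m)) \<pi>"
          have len: "k < length ?h" using \<open>m \<noteq> 0\<close> n by simp
          have hj: "?h ! j = \<pi> j" if "j \<le> k" for j using that len by (simp del: subseq_to_Suc)
          have "(LEAST k. ?h ! k \<noteq> \<rho> k) = k"
          proof (rule Least_equality)
            show "?h ! k \<noteq> \<rho> k" using hj[of k] k by simp
            fix j assume "?h ! j \<noteq> \<rho> j"
            then show "k \<le> j" using hj[of j] before[of j] by (metis leI less_imp_le)
          qed
          then have d: "d ?h = n" by (simp add: d_def n del: subseq_to_Suc)
          have "?h \<noteq> prefix (length ?h) \<rho>"
          proof
            assume "?h = prefix (length ?h) \<rho>"
            then have "\<pi> k = \<rho> k" using prefix_eqD[of \<pi> "Suc (n + m)" \<rho> k] len by (simp del: subseq_to_Suc)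
            then show False using k by simp
          qed
          moreover have "\<pi> (Suc (n + m)) = \<sigma> (own (\<pi> (n + m))) ?h"
            using \<pi>_Suc[of "n + m"] that own_n by simp
          ultimately have "\<pi> (Suc (n + m)) = s n (drop n ?h)" using d by (simp add: \<sigma>_def del: subseq_to_Suc)
          then show ?thesis by (simp del: subseq_to_Suc)
        qed
        have "is_play E \<pi>"
          unfolding \<pi>_def by (rule is_play_outcome) (use \<tau> \<sigma> in simp)
        then have "is_play E (suffix n \<pi>)" by (simp add: is_play_def)
        then have "(suffix n \<pi>, \<rho>) \<in> pref i"
          using punish[of "suffix n \<pi>" n] follow before[of n] n own_n by simp
        then show ?thesis using R_suffix by simp
      qed
      then show ?thesis by (simp add: strict_pref_def \<pi>_def)
    qed
    then have "nash_eq E P own pref \<sigma> (\<rho> 0)"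
      using \<sigma> out by (simp add: nash_eq_def)
    then show "\<exists>\<sigma>. nash_eq E P own pref \<sigma> (\<rho> 0) \<and> outcome own \<sigma> (\<rho> 0) = \<rho>"
      using out by blast
  qed
qed

end
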